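(* Let $n\ge 2$, $1\le d\le n-1$ and $s\in\mathbb R$. Let $w:\mathbb Z^n\times\mathbf{Gr}(d,n)\to(0,\infty)$ be a weight function such that $w(\cdot,A)$ is at most of polynomial decay for each fixed $A\in\mathbf{Gr}(d,n)$. For $k\in\mathbb Z^n$ let $\Omega_k:=\{A\in\mathbf{Gr}(d,n):k\perp A\}$ and $W_k:=\sum_{A\in\Omega_k}w(k,A)^2$. Suppose that there exist $C_w>0$ and $c_w>0$ such that $c_w^2\le W_k\le C_w^2$ for every $k\in\mathbb Z^n$. Then: (i) $F_{W_k^{-1}}R_d^*:L^{2,2}_s(X_{d,n};w)\to H^s(\mathbb T^n)$ is $1/c_w$-Lipschitz. (ii) For every $f\in\mathcal T'$, $\displaystyle \|f\|_{H^s(\mathbb T^n)}\le\frac1{c_w}\|R_df\|_{L^{2,2}_s(X_{d,n};w)}$. (iii) Let $\tilde w(k,A)=\frac{w(k,A)}{\sqrt{W_k}}$ and $p\in[1,\infty]$. Then $R_d^{*,\tilde w}R_df=f$ and $\|f\|_{L^p_s(\mathbb T^n)}=\|R_d^{*,\tilde w}R_df\|_{L^p_s(\mathbb T^n)}$ for every $f\in\mathcal T'$.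
   Context: $\mathbb T^n=\mathbb R^n/\mathbb Z^n$, $\mathcal T=C^\infty(\mathbb T^n)$, and $\mathcal T'$ is the space of distributions on $\mathbb T^n$, with Fourier coefficients $\hat f(k)=f(e^{-2\pi i k\cdot x})$, $k\in\mathbb Z^n$. $\langle k\rangle=(1+|k|^2)^{1/2}$. The norms are $\|f\|_{L^p_s(\mathbb T^n)}=\left\|\sum_{k\in\mathbb Z^n}\langle k\rangle^s\hat f(k)e^{2\pi ik\cdot x}\right\|_{L^p(\mathbb T^n)}$ and $\|f\|_{H^s(\mathbb T^n)}=(\sum_{k\in\mathbb Z^n}\langle k\rangle^{2s}|\hat f(k)|^2)^{1/2}$; norms take the value $+\infty$ when not finite, and $H^s(\mathbb T^n)$ consists of $f\in\mathcal T'$ with finite $H^s$ norm. For a function $\omega$ on $\mathbb Z^n$, $F_\omega$ denotes the Fourier multiplier $\widehat{F_\omega f}(k)=\omega(k)\hat f(k)$; thus $F_{W_k^{-1}}$ has symbol $k\mapsto W_k^{-1}$. $\mathbf{Gr}(d,n)$ is the collection of $d$-dimensional linear subspaces of $\mathbb Q^n$, and $k\perp A$ means $k$ is orthogonal to every vector of $A$. For $A\in\mathbf{Gr}(d,n)$ with a basis of integer vectors $v_1,\dots,v_d\in\mathbb Z^n$, the $d$-plane Radon transform of $f\in\mathcal T$ is $$R_df(x,A)=R_{d,A}f(x)=\int_{[0,1]^d}f(x+t_1v_1+\cdots+t_dv_d)\,dt_1\cdots dt_d,$$ which does not depend on the choice of integer basis of $A$. For $f\in\mathcal T'$, $R_{d,A}f\in\mathcal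 T'$ is defined by duality (using that $R_{d,A}:\mathcal T\to\mathcal T$ is formally $L^2$ self-adjoint), and $R_df$ is the family $A\mapsto R_df(\cdot,A)=R_{d,A}f$. $X_{d,n}=\mathbb T^n\times\mathbf{Gr}(d,n)$. A function $\omega:\mathbb Z^n\to(0,\infty)$ is at most of polynomial decay if there are $C,N>0$ with $\omega(k)\ge C\langle k\rangle^{-N}$ for all $k$. $L^{2,2}_s(X_{d,n};w)$ is the Hilbert space of families $g$ with $g(\cdot,A)\in\mathcal T'$ for each $A$ and finite norm $$\|g\|^2_{L^{2,2}_s(X_{d,n};w)}=\sum_{A\in\mathbf{Gr}(d,n)}\sum_{k\in\mathbb Z^n}w(k,A)^2\langle k\rangle^{2s}|\hat g(k,A)|^2,$$ where $\hat g(k,A)$ is the $k$-th Fourier coefficient of $g(\cdot,A)$. $R_d^*$ is the adjoint of $R_d:H^s(\mathbb T^n)\to L^{2,2}_s(X_{d,n};w)$, given by $\widehat{R_d^*g}(k)=\sum_{A\in\Omega_k}w(k,A)^2\hat g(k,A)$. $R_d^{*,\tilde w}$ is the corresponding adjoint for the weight $\tilde w$ in place of $w$, i.e. $\widehat{R_d^{*,\tilde w}g}(k)=\sum_{A\in\Omega_k}\tilde w(k,A)^2\hat g(k,A)$, and this formula defines it also on $R_d(\mathcal T')$. *)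

theory Defs
  imports "HOL-Analysis.Analysis" "HOL-Probability.Essential_Supremum"
begin

subsection \<open>The torus and its lattice of frequencies\<close>

text \<open>
  Functions on \<open>\<real>\<^sup>n/\<int>\<^sup>n\<close> are represented by \<open>\<int>\<^sup>n\<close>-periodic functions on \<open>\<real>\<^sup>n\<close>; integrals and
  \<open>L\<^sup>p\<close> norms are taken over the closed unit cube, whose overlapping faces form a null set.
\<close>

definition torus :: "(real^'n) measure" where
  "torus = restrict_space lborel (cbox 0 1)"

definition real_vec :: "int^'n \<Rightarrow> real^'n" where
  "real_vec k = (\<chi> i. of_int (k $ i))"

definition rat_vec :: "int^'n \<Rightarrow> rat^'n" where
  "rat_vec k = (\<chi> i. of_int (k $ i))"

definition bracket :: "int^'n \<Rightarrow> real" where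
  "bracket k = sqrt (1 + (norm (real_vec k))\<^sup>2)"

definition fourier_char :: "int^'n \<Rightarrow> real^'n \<Rightarrow> complex" where
  "fourier_char k x = cis (2 * pi * (real_vec k \<bullet> x))"

definition poly_decay :: "(int^'n \<Rightarrow> real) \<Rightarrow> bool" where
  "poly_decay \<omega> \<longleftrightarrow> (\<exists>C>0. \<exists>N>0. \<forall>k. \<omega> k \<ge> C * bracket k powr (- N))"


subsection \<open>Test functions and distributions\<close>

definition partial_deriv :: "'n \<Rightarrow> (real^'n \<Rightarrow> complex) \<Rightarrow> real^'n \<Rightarrow> complex" where
  "partial_deriv i \<phi> x = vector_derivative (\<lambda>t. \<phi> (x + t *\<^sub>R axis i 1)) (at 0)"

fun iter_partial :: "'n list \<Rightarrow> (real^'n \<Rightarrow> complex) \<Rightarrow> real^'n \<Rightarrow> complex" where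
  "iter_partial [] \<phi> = \<phi>"
| "iter_partial (i # js) \<phi> = partial_deriv i (iter_partial js \<phi>)"

definition test_functions :: "(real^'n \<Rightarrow> complex) set" where
  "test_functions = {\<phi>.
     (\<forall>k x. \<phi> (x + real_vec k) = \<phi> x) \<and>
     (\<forall>js. iter_partial js \<phi> differentiable_on UNIV)}"

text \<open>
  A distribution is a linear functional on test functions that is continuous for the \<open>C\<^sup>\<infinity>\<close>
  topology, i.e. bounded by finitely many of the seminorms \<open>sup \<bar>\<partial>\<^sup>\<alpha>\<phi>\<bar>\<close> (these suprema are finite by
  periodicity). Functionals are normalised to be \<open>0\<close> off the test functions, so that
  equality of distributions is equality in HOL, and \<open>u - v\<close> is the pointwise difference.
\<close>

definition distributions :: "((real^'n \<Rightarrow> complex) \<Rightarrow> complex) set" where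
  "distributions = {u.
     (\<forall>\<phi>\<in>test_functions. \<forall>\<psi>\<in>test_functions. u (\<lambda>x. \<phi> x + \<psi> x) = u \<phi> + u \<psi>) \<and>
     (\<forall>c. \<forall>\<phi>\<in>test_functions. u (\<lambda>x. c * \<phi> x) = c * u \<phi>) \<and>
     (\<exists>C N. \<forall>\<phi>\<in>test_functions.
        norm (u \<phi>) \<le> C * (\<Sum>js\<in>{js. length js \<le> N}. SUP x. norm (iter_partial js \<phi> x))) \<and>
     (\<forall>\<phi>. \<phi> \<notin> test_functions \<longrightarrow> u \<phi> = 0)}"

definition distr_of :: "(real^'n \<Rightarrow> complex) \<Rightarrow> (real^'n \<Rightarrow> complex) \<Rightarrow> complex" where
  "distr_of h \<phi> = (if \<phi> \<in> test_functions then (\<integral>x. h x * \<phi> x \<partial>torus) else 0)"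

definition fourier_coeff :: "((real^'n \<Rightarrow> complex) \<Rightarrow> complex) \<Rightarrow> int^'n \<Rightarrow> complex" where
  "fourier_coeff u k = u (fourier_char (- k))"

text \<open>
  The distribution \<open>\<Sum>\<^sub>k a(k) e\<^sup>2\<^sup>\<pi>\<^sup>i\<^sup>k\<^sup>\<sdot>\<^sup>x\<close>, with the series converging in the sense of
  distributions; it is meaningful for coefficients \<open>a\<close> of at most polynomial growth.
\<close>

definition fourier_series :: "(int^'n \<Rightarrow> complex) \<Rightarrow> (real^'n \<Rightarrow> complex) \<Rightarrow> complex" where
  "fourier_series a \<phi> = (\<Sum>\<^sub>\<infinity>k. a k * distr_of (fourier_char k) \<phi>)"

definition fourier_multiplier ::
  "(int^'n \<Rightarrow> complex) \<Rightarrow> ((real^'n \<Rightarrow> complex) \<Rightarrow> complex) \<Rightarrow> (real^'n \<Rightarrow> complex) \<Rightarrow> complex" where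
  "fourier_multiplier \<omega> u = fourier_series (\<lambda>k. \<omega> k * fourier_coeff u k)"


subsection \<open>Norms, with values in the extended nonnegative reals\<close>

definition ennreal_powr :: "ennreal \<Rightarrow> real \<Rightarrow> ennreal" where
  "ennreal_powr a r = (if a = \<infinity> then \<infinity> else ennreal (enn2real a powr r))"

definition Lp_norm :: "ennreal \<Rightarrow> (real^'n \<Rightarrow> complex) \<Rightarrow> ennreal" where
  "Lp_norm p h =
     (if p = \<infinity> then esssup torus (\<lambda>x. ennreal (norm (h x)))
      else ennreal_powr (\<integral>\<^sup>+x. ennreal (norm (h x) powr enn2real p) \<partial>torus) (1 / enn2real p))"

text \<open>
  The integrable functions \<open>h\<close> representing a given distribution agree almost everywhere, so the
  infimum below is their common \<open>L\<^sup>p\<close> norm; it is \<open>\<infinity>\<close> if the distribution is not a function.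
\<close>

definition Lp_norm_distr :: "ennreal \<Rightarrow> ((real^'n \<Rightarrow> complex) \<Rightarrow> complex) \<Rightarrow> ennreal" where
  "Lp_norm_distr p u = (INF h\<in>{h. integrable torus h \<and> distr_of h = u}. Lp_norm p h)"

definition Lps_norm :: "ennreal \<Rightarrow> real \<Rightarrow> ((real^'n \<Rightarrow> complex) \<Rightarrow> complex) \<Rightarrow> ennreal" where
  "Lps_norm p s u =
     Lp_norm_distr p (fourier_series (\<lambda>k. of_real (bracket k powr s) * fourier_coeff u k))"

definition Hs_norm :: "real \<Rightarrow> ((real^'n \<Rightarrow> complex) \<Rightarrow> complex) \<Rightarrow> ennreal" where
  "Hs_norm s u =
     ennreal_powr (\<Sum>\<^sub>\<infinity>k. ennreal (bracket k powr (2 * s) * (norm (fourier_coeff u k))\<^sup>2)) (1/2)"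

definition Hs_space :: "real \<Rightarrow> ((real^'n \<Rightarrow> complex) \<Rightarrow> complex) set" where
  "Hs_space s = {u \<in> distributions. Hs_norm s u < \<infinity>}"


subsection \<open>The \<open>d\<close>-plane Radon transform\<close>

definition Gr :: "nat \<Rightarrow> (rat^'n) set set" where
  "Gr d = {A. vec.subspace A \<and> vec.dim A = d}"

definition orthogonal_to :: "int^'n \<Rightarrow> (rat^'n) set \<Rightarrow> bool" where
  "orthogonal_to k A \<longleftrightarrow> (\<forall>a\<in>A. (\<Sum>i\<in>UNIV. of_int (k $ i) * a $ i) = 0)"

definition \<Omega> :: "nat \<Rightarrow> int^'n \<Rightarrow> (rat^'n) set set" where
  "\<Omega> d k = {A \<in> Gr d. orthogonal_to k A}"

definition integer_basis :: "nat \<Rightarrow> (rat^'n) set \<Rightarrow> (nat \<Rightarrow> int^'n) \<Rightarrow> bool" where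
  "integer_basis d A v \<longleftrightarrow>
     inj_on (\<lambda>j. rat_vec (v j)) {..<d} \<and>
     vec.independent ((\<lambda>j. rat_vec (v j)) ` {..<d}) \<and>
     vec.span ((\<lambda>j. rat_vec (v j)) ` {..<d}) = A"

definition radon_along :: "nat \<Rightarrow> (nat \<Rightarrow> int^'n) \<Rightarrow> (real^'n \<Rightarrow> complex) \<Rightarrow> real^'n \<Rightarrow> complex" where
  "radon_along d v \<phi> x =
     (\<integral>t. \<phi> (x + (\<Sum>j<d. t j *\<^sub>R real_vec (v j))) \<partial>(\<Pi>\<^sub>M j\<in>{..<d}. restrict_space lborel {0..1}))"

text \<open>The value does not depend on the integer basis that is chosen.\<close>

definition radon_test :: "nat \<Rightarrow> (rat^'n) set \<Rightarrow> (real^'n \<Rightarrow> complex) \<Rightarrow> real^'n \<Rightarrow> complex" where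
  "radon_test d A = radon_along d (SOME v. integer_basis d A v)"

text \<open>Extension to distributions by duality, the transform being formally self-adjoint.\<close>

definition radon ::
  "nat \<Rightarrow> ((real^'n \<Rightarrow> complex) \<Rightarrow> complex) \<Rightarrow> (rat^'n) set \<Rightarrow> (real^'n \<Rightarrow> complex) \<Rightarrow> complex" where
  "radon d u A \<phi> = (if \<phi> \<in> test_functions then u (radon_test d A \<phi>) else 0)"


subsection \<open>Weighted spaces on \<open>\<T>\<^sup>n \<times> Gr(d, n)\<close> and the adjoint transform\<close>

text \<open>Values of \<open>g\<close> and of \<open>w k\<close> outside \<open>Gr d\<close> are irrelevant.\<close>

definition L22_norm ::
  "nat \<Rightarrow> real \<Rightarrow> (int^'n \<Rightarrow> (rat^'n) set \<Rightarrow> real) \<Rightarrow>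
   ((rat^'n) set \<Rightarrow> (real^'n \<Rightarrow> complex) \<Rightarrow> complex) \<Rightarrow> ennreal" where
  "L22_norm d s w g =
     ennreal_powr (\<Sum>\<^sub>\<infinity>A\<in>Gr d. \<Sum>\<^sub>\<infinity>k.
       ennreal ((w k A)\<^sup>2 * bracket k powr (2 * s) * (norm (fourier_coeff (g A) k))\<^sup>2)) (1/2)"

definition L22_space ::
  "nat \<Rightarrow> real \<Rightarrow> (int^'n \<Rightarrow> (rat^'n) set \<Rightarrow> real) \<Rightarrow>
   ((rat^'n) set \<Rightarrow> (real^'n \<Rightarrow> complex) \<Rightarrow> complex) set" where
  "L22_space d s w = {g. (\<forall>A\<in>Gr d. g A \<in> distributions) \<and> L22_norm d s w g < \<infinity>}"

text \<open>
  \<open>W\<^sub>k\<close>. A divergent sum yields \<open>0\<close> here; this is excluded by any positive lower bound on \<open>W\<^sub>k\<close>.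
\<close>

definition weight_sum :: "nat \<Rightarrow> (int^'n \<Rightarrow> (rat^'n) set \<Rightarrow> real) \<Rightarrow> int^'n \<Rightarrow> real" where
  "weight_sum d w k = (\<Sum>\<^sub>\<infinity>A\<in>\<Omega> d k. (w k A)\<^sup>2)"

text \<open>
  \<open>R\<^sub>d\<^sup>*\<close> for the weight \<open>w\<close>: the distribution whose \<open>k\<close>-th Fourier coefficient is
  \<open>\<Sum>\<^sub>A\<^sub>\<in>\<^sub>\<Omega>\<^sub>k w(k,A)\<^sup>2 g(\<cdot>,A)^(k)\<close>. Taking the formula as the definition makes the operator available also on
  families outside \<open>L22_space\<close>, such as \<open>radon d u\<close> for an arbitrary distribution \<open>u\<close>.
\<close>

definition radon_adjoint ::
  "nat \<Rightarrow> (int^'n \<Rightarrow> (rat^'n) set \<Rightarrow> real) \<Rightarrow>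
   ((rat^'n) set \<Rightarrow> (real^'n \<Rightarrow> complex) \<Rightarrow> complex) \<Rightarrow> (real^'n \<Rightarrow> complex) \<Rightarrow> complex" where
  "radon_adjoint d w g =
     fourier_series (\<lambda>k. \<Sum>\<^sub>\<infinity>A\<in>\<Omega> d k. of_real ((w k A)\<^sup>2) * fourier_coeff (g A) k)"

end

theory Submission
  imports Defs
begin

text \<open>
  The statement becomes elementary on the Fourier side. A character \<open>e\<^sub>k\<close> is constant along the
  directions of \<open>A\<close> if \<open>k \<bottom> A\<close>, and otherwise it oscillates over whole periods in some basis
  direction, so that its average vanishes. Hence \<open>R\<^sub>d\<^sub>,\<^sub>A\<close> keeps the frequencies orthogonal to \<open>A\<close> and
  removes all others (\<open>fourier_coeff_radon\<close>). Both \<open>F\<^bsub>1/W\<^esub> R\<^sub>d\<^sup>*\<close> and the adjoint for the normalised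
  weight therefore send a family \<open>g\<close> to the Fourier series whose \<open>k\<close>-th coefficient is the mean of
  the numbers \<open>g(\<cdot>,A)^(k)\<close>, \<open>A \<in> \<Omega>\<^sub>k\<close>, with the weights \<open>w(k,A)\<^sup>2 / W\<^sub>k\<close>.

  For \<open>g = R\<^sub>d f\<close> these numbers all equal \<open>f^(k)\<close>, and so does their mean (\<open>average_radon\<close>). For an
  arbitrary \<open>g\<close> the Cauchy-Schwarz inequality bounds the squared mean by \<open>W\<^sub>k\<^sup>-\<^sup>1\<close> times the weighted sum
  of squares; with \<open>W\<^sub>k \<ge> c\<^sub>w\<^sup>2\<close>, summation over \<open>k\<close> and interchange of the two sums this is the
  estimate \<open>average_bound\<close>. It gives the Lipschitz bound when applied to \<open>g - h\<close>, since means are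
  linear, and the stability estimate when applied to \<open>R\<^sub>d f\<close>.

  What makes this a statement about distributions is that every distribution is the sum of its
  Fourier series (\<open>distribution_fourier_series\<close>), so that the inversion formula for the coefficients
  is an inversion formula for \<open>f\<close> itself. By continuity it suffices that the Fourier series of a
  test function converges to it together with all derivatives. Differentiation commutes with partial
  Fourier sums, so uniform convergence is enough. The series converges uniformly to some continuous
  function because integration by parts makes the coefficients decay rapidly, and its sum has the
  same coefficients as the test function. That continuous periodic functions with equal coefficients
  agree (\<open>fourier_uniqueness\<close>) is deduced from the Stone-Weierstrass theorem.
\<close>

section \<open>Partial derivatives and test functions\<close>

lemma has_vector_derivative_along_axis:
  assumes "(\<phi> has_derivative D) (at (x + t *\<^sub>R axis i 1))"
  shows "((\<lambda>t. \<phi> (x + t *\<^sub>R axis i 1)) has_vector_derivative D (axis i 1)) (at t)"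
proof -
  have "((\<lambda>t::real. x + t *\<^sub>R axis i 1) has_derivative (\<lambda>t. t *\<^sub>R axis i 1)) (at t)"
    by (auto intro!: derivative_eq_intros)
  from has_derivative_compose[OF this assms]
  have "((\<lambda>t::real. \<phi> (x + t *\<^sub>R axis i 1)) has_derivative (\<lambda>t. D (t *\<^sub>R axis i 1))) (at t)" .
  moreover have "D (t *\<^sub>R axis i 1) = t *\<^sub>R D (axis i 1)" for t
    using has_derivative_bounded_linear[OF assms] by (simp add: linear_simps)
  ultimately show ?thesis by (simp add: has_vector_derivative_def)
qed

text \<open>
  Partial derivatives are defined through vector derivatives along lines; for differentiable
  functions this lemma reduces their calculus to that of total derivatives.
\<close>

lemma partial_deriv_eq:
  assumes "(\<phi> has_derivative D) (at x)"
  shows "partial_deriv i \<phi> x = D (axis i 1)"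
  unfolding partial_deriv_def
  using has_vector_derivative_along_axis[of \<phi> D x 0 i] assms
  by (simp add: vector_derivative_at)

lemma has_vector_derivative_partial_deriv:
  assumes "\<phi> differentiable (at (x + t *\<^sub>R axis i 1))"
  shows "((\<lambda>t. \<phi> (x + t *\<^sub>R axis i 1)) has_vector_derivative
           partial_deriv i \<phi> (x + t *\<^sub>R axis i 1)) (at t)"
proof -
  obtain D where D: "(\<phi> has_derivative D) (at (x + t *\<^sub>R axis i 1))"
    using assms by (auto simp: differentiable_def)
  show ?thesis
    unfolding partial_deriv_eq[OF D] by (rule has_vector_derivative_along_axis[OF D])
qed

lemma partial_deriv_add:
  assumes "\<phi> differentiable_on UNIV" "\<psi> differentiable_on UNIV"
  shows "partial_deriv i (\<lambda>x. \<phi> x + \<psi> x) = (\<lambda>x. partial_deriv i \<phi> x + partial_deriv i \<psi> x)"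
proof
  fix x
  obtain D E where "(\<phi> has_derivative D) (at x)" "(\<psi> has_derivative E) (at x)"
    using assms unfolding differentiable_on_def differentiable_def by (meson UNIV_I)
  then show "partial_deriv i (\<lambda>x. \<phi> x + \<psi> x) x = partial_deriv i \<phi> x + partial_deriv i \<psi> x"
    using partial_deriv_eq[OF has_derivative_add] by (simp add: partial_deriv_eq)
qed

lemma partial_deriv_mult:
  assumes "\<phi> differentiable_on UNIV" "\<psi> differentiable_on UNIV"
  shows "partial_deriv i (\<lambda>x. \<phi> x * \<psi> x) =
           (\<lambda>x. \<phi> x * partial_deriv i \<psi> x + partial_deriv i \<phi> x * \<psi> x)"
proof
  fix x
  obtain D E where "(\<phi> has_derivative D) (at x)" "(\<psi> has_derivative E) (at x)"
    using assms unfolding differentiable_on_def differentiable_def by (meson UNIV_I)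
  then show "partial_deriv i (\<lambda>x. \<phi> x * \<psi> x) x =
      \<phi> x * partial_deriv i \<psi> x + partial_deriv i \<phi> x * \<psi> x"
    using partial_deriv_eq[OF has_derivative_mult] by (simp add: partial_deriv_eq)
qed

lemma partial_deriv_const: "partial_deriv i (\<lambda>x. c) = (\<lambda>x. 0)"
  by (simp add: fun_eq_iff partial_deriv_eq[OF has_derivative_const])

lemma partial_deriv_cmult:
  assumes "\<phi> differentiable_on UNIV"
  shows "partial_deriv i (\<lambda>x. c * \<phi> x) = (\<lambda>x. c * partial_deriv i \<phi> x)"
  using partial_deriv_mult[OF _ assms, of "\<lambda>x. c" i] by (simp add: partial_deriv_const)

lemma iter_partial_append: "iter_partial (js @ ks) \<phi> = iter_partial js (iter_partial ks \<phi>)"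
  by (induction js) auto

lemma iter_partial_periodic:
  assumes "\<And>k x. \<phi> (x + real_vec k) = \<phi> x"
  shows "iter_partial js \<phi> (x + real_vec k) = iter_partial js \<phi> x"
  by (induction js arbitrary: x)
     (simp_all add: assms partial_deriv_def add.assoc add.commute[of "real_vec k"],
      simp add: add.assoc[symmetric])

lemma test_functions_periodic: "\<phi> \<in> test_functions \<Longrightarrow> \<phi> (x + real_vec k) = \<phi> x"
  by (simp add: test_functions_def)

lemma test_functions_differentiable: "\<phi> \<in> test_functions \<Longrightarrow> iter_partial js \<phi> differentiable_on UNIV"
  by (simp add: test_functions_def)

lemma iter_partial_test_functions:
  assumes "\<phi> \<in> test_functions" shows "iter_partial js \<phi> \<in> test_functions"
  using assms iter_partial_periodic[of \<phi> js]
  by (simp add: test_functions_def flip: iter_partial_append)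

lemma test_functions_continuous:
  assumes "\<phi> \<in> test_functions" shows "continuous_on S \<phi>"
  using test_functions_differentiable[OF assms, of "[]"]
  by (auto intro: continuous_on_subset[OF differentiable_imp_continuous_on])

lemma iter_partial_add:
  assumes "\<phi> \<in> test_functions" "\<psi> \<in> test_functions"
  shows "iter_partial js (\<lambda>x. \<phi> x + \<psi> x) = (\<lambda>x. iter_partial js \<phi> x + iter_partial js \<psi> x)"
  using assms by (induction js) (simp_all add: partial_deriv_add test_functions_differentiable)

lemma iter_partial_cmult:
  assumes "\<phi> \<in> test_functions"
  shows "iter_partial js (\<lambda>x. c * \<phi> x) = (\<lambda>x. c * iter_partial js \<phi> x)"
  using assms by (induction js) (simp_all add: partial_deriv_cmult test_functions_differentiable)

lemma test_functions_add:
  assumes "\<phi> \<in> test_functions" "\<psi> \<in> test_functions"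
  shows "(\<lambda>x. \<phi> x + \<psi> x) \<in> test_functions"
  using assms differentiable_on_add
  by (auto simp: test_functions_def iter_partial_add[OF assms])

lemma test_functions_cmult:
  assumes "\<phi> \<in> test_functions"
  shows "(\<lambda>x. c * \<phi> x) \<in> test_functions"
  using assms
  by (auto simp: test_functions_def iter_partial_cmult[OF assms]
      intro!: differentiable_on_mult)

lemma iter_partial_zero: "iter_partial js (\<lambda>x::real^'n. 0) = (\<lambda>x. 0)"
  by (induction js) (simp_all add: partial_deriv_const)

lemma test_functions_zero: "(\<lambda>x. 0) \<in> test_functions"
  by (simp add: test_functions_def iter_partial_zero)

lemma test_functions_sum:
  "(\<And>k. k \<in> F \<Longrightarrow> \<phi> k \<in> test_functions) \<Longrightarrow> (\<lambda>x. \<Sum>k\<in>F. \<phi> k x) \<in> test_functions"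
  by (induction F rule: infinite_finite_induct) (simp_all add: test_functions_zero test_functions_add)

lemma iter_partial_sum:
  "(\<And>k. k \<in> F \<Longrightarrow> \<phi> k \<in> test_functions) \<Longrightarrow>
     iter_partial js (\<lambda>x. \<Sum>k\<in>F. \<phi> k x) = (\<lambda>x. \<Sum>k\<in>F. iter_partial js (\<phi> k) x)"
  by (induction F rule: infinite_finite_induct)
     (simp_all add: iter_partial_zero iter_partial_add test_functions_sum)

section \<open>Characters of the torus\<close>

lemma inner_real_vec: "real_vec k \<bullet> real_vec l = of_int (\<Sum>i\<in>UNIV. k $ i * l $ i)"
  by (simp add: real_vec_def inner_vec_def)

lemma real_vec_simps [simp]:
  "real_vec 0 = 0" "real_vec (- k) = - real_vec k" "real_vec (k + l) = real_vec k + real_vec l"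
  by (simp_all add: real_vec_def vec_eq_iff)

lemma fourier_char_periodic: "fourier_char k (x + real_vec l) = fourier_char k x"
proof -
  have "cis (2 * pi * of_int (\<Sum>i\<in>UNIV. k $ i * l $ i)) = 1"
    by (rule cis_multiple_2pi) (rule Ints_of_int)
  then show ?thesis
    by (simp only: fourier_char_def inner_add_right inner_real_vec distrib_left
        cis_mult[symmetric] mult_1_right)
qed

lemma fourier_char_0 [simp]: "fourier_char 0 x = 1"
  by (simp add: fourier_char_def)

lemma fourier_char_mult: "fourier_char k x * fourier_char l x = fourier_char (k + l) x"
  by (simp add: fourier_char_def cis_mult inner_add_left distrib_left)

lemma norm_fourier_char [simp]: "norm (fourier_char k x) = 1"
  by (simp add: fourier_char_def)

lemma fourier_char_has_derivative:
  "(fourier_char k has_derivative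
     (\<lambda>h. of_real (2 * pi * (real_vec k \<bullet> h)) * \<i> * fourier_char k x)) (at x)"
proof -
  have "((\<lambda>x. \<i> * of_real (2 * pi * (real_vec k \<bullet> x))) has_derivative
      (\<lambda>h. \<i> * of_real (2 * pi * (real_vec k \<bullet> h)))) (at x)"
    by (auto intro!: derivative_eq_intros)
  from has_derivative_compose[OF this DERIV_exp[unfolded has_field_derivative_def]]
  show ?thesis
    by (simp add: fourier_char_def[abs_def] cis_conv_exp mult_ac)
qed

text \<open>
  The eigenvalue of \<open>\<partial>\<^sub>i\<close> on the character \<open>e\<^sub>k\<close>.
\<close>

definition deriv_symbol :: "'n \<Rightarrow> int^'n \<Rightarrow> complex" where
  "deriv_symbol i k = 2 * of_real pi * \<i> * of_int (k $ i)"

lemma partial_deriv_fourier_char: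
  "partial_deriv i (fourier_char k) = (\<lambda>x. deriv_symbol i k * fourier_char k x)"
  by (rule ext, subst partial_deriv_eq[OF fourier_char_has_derivative])
     (simp add: inner_axis real_vec_def deriv_symbol_def)

lemma fourier_char_differentiable: "fourier_char k differentiable_on S"
  using fourier_char_has_derivative differentiable_at_imp_differentiable_on differentiable_def by blast

lemma iter_partial_fourier_char:
  "iter_partial js (fourier_char k) = (\<lambda>x. (\<Prod>j\<leftarrow>js. deriv_symbol j k) * fourier_char k x)"
  by (induction js) 
     (simp_all add: partial_deriv_cmult fourier_char_differentiable partial_deriv_fourier_char,
      simp_all add: mult_ac)

lemma fourier_char_test_function: "fourier_char k \<in> test_functions"
  by (auto simp: test_functions_def fourier_char_periodic iter_partial_fourier_char
      intro!: differentiable_on_mult fourier_char_differentiable)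

section \<open>Integration by parts on the torus\<close>

lemma torus_integral_eq:
  fixes h :: "real^'n \<Rightarrow> 'b::euclidean_space"
  assumes "continuous_on (cbox 0 1) h"
  shows "(\<integral>x. h x \<partial>torus) = integral (cbox 0 1) h"
proof -
  have int: "set_integrable lborel (cbox 0 1) h"
    unfolding set_integrable_def
    using borel_integrable_compact[OF compact_cbox assms] 
    by (simp add: indicator_scaleR_eq_if)
  show "(\<integral>x. h x \<partial>torus) = integral (cbox 0 1) h"
    using set_borel_integral_eq_integral(2)[OF int]
    by (simp add: torus_def integral_restrict_space set_lebesgue_integral_def)
qed

lemma mem_unit_cube: "x \<in> cbox 0 (1::real^'n) \<longleftrightarrow> (\<forall>i. 0 \<le> x $ i \<and> x $ i \<le> 1)"
  by (simp add: mem_box_cart)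

lemma content_unit_cube [simp]: "measure lborel (cbox 0 (1::real^'n)) = 1"
  by (simp add: content_cbox_if_cart interval_eq_empty_cart)

text \<open>
  Shifting the cube by \<open>t\<close> in direction \<open>i\<close> makes the slab \<open>1 \<le> x\<^sub>i \<le> 1 + t\<close> stick out on one
  side. By periodicity this slab carries the same integral as the slab \<open>0 \<le> x\<^sub>i \<le> t\<close> that was
  uncovered on the other side.
\<close>

lemma cube_integral_shift:
  fixes \<psi> :: "real^'n \<Rightarrow> complex"
  assumes cont: "continuous_on UNIV \<psi>" and per: "\<And>k x. \<psi> (x + real_vec k) = \<psi> x"
    and t: "0 \<le> t" "t \<le> 1"
  shows "integral (cbox 0 1) (\<lambda>x. \<psi> (x + t *\<^sub>R axis i 1)) = integral (cbox 0 1) \<psi>"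
proof -
  let ?e = "axis i 1 :: real^'n"
  let ?I = "\<lambda>S. integral S \<psi>"
  have int: "\<psi> integrable_on cbox a b" for a b
    by (rule integrable_continuous) (rule continuous_on_subset[OF cont], simp)
  have e: "?e \<in> Basis" by (simp add: axis_in_Basis_iff)
  have shift: "integral (cbox a b) (\<lambda>x. \<psi> (x + c)) = ?I (cbox (a + c) (b + c))" for a b c
    using integral_shift_cbox[of "a + c" c "b + c" \<psi>] by simp
  have shift1: "?I (cbox (a + ?e) (b + ?e)) = ?I (cbox a b)" for a b
  proof -
    have "?e = real_vec (axis i 1)"
      by (simp add: real_vec_def axis_def vec_eq_iff)
    then have "(\<lambda>x. \<psi> (x + ?e)) = \<psi>" by (simp add: per)
    then show ?thesis using shift[of a b ?e] by simp
  qed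
  have comp: "x \<bullet> ?e = x $ i" for x by (simp add: inner_axis)
  have coords: "x \<in> cbox a b \<longleftrightarrow> a $ i \<le> x $ i \<and> x $ i \<le> b $ i \<and>
      (\<forall>j. j \<noteq> i \<longrightarrow> a $ j \<le> x $ j \<and> x $ j \<le> b $ j)" for x a b :: "real^'n"
    by (auto simp: mem_box_cart)
  \<comment> \<open>The upper corner of the slab \<open>0 \<le> x\<^sub>i \<le> t\<close> of the cube.\<close>
  let ?m = "1 - (1 - t) *\<^sub>R ?e"
  have "integral (cbox 0 1) (\<lambda>x. \<psi> (x + t *\<^sub>R ?e)) = ?I (cbox (t *\<^sub>R ?e) (1 + t *\<^sub>R ?e))"
    by (simp add: shift)
  also have "\<dots> = ?I (cbox (t *\<^sub>R ?e) (1 + t *\<^sub>R ?e) \<inter> {x. x \<bullet> ?e \<le> 1})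
                + ?I (cbox (t *\<^sub>R ?e) (1 + t *\<^sub>R ?e) \<inter> {x. x \<bullet> ?e \<ge> 1})"
    by (rule integral_split[OF int e])
  also have "cbox (t *\<^sub>R ?e) (1 + t *\<^sub>R ?e) \<inter> {x. x \<bullet> ?e \<le> 1} = cbox (t *\<^sub>R ?e) 1"
    unfolding comp by (rule set_eqI) (use t in \<open>auto simp: coords axis_def\<close>)
  also have "cbox (t *\<^sub>R ?e) (1 + t *\<^sub>R ?e) \<inter> {x. x \<bullet> ?e \<ge> 1} = cbox (0 + ?e) (?m + ?e)"
    unfolding comp by (rule set_eqI) (use t in \<open>auto simp: coords axis_def\<close>)
  also have "?I (cbox (0 + ?e) (?m + ?e)) = ?I (cbox 0 ?m)"
    by (rule shift1)
  also have "cbox (t *\<^sub>R ?e) 1 = cbox 0 1 \<inter> {x. x \<bullet> ?e \<ge> t}"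
    unfolding comp by (rule set_eqI) (use t in \<open>auto simp: coords axis_def\<close>)
  also have "cbox 0 ?m = cbox 0 1 \<inter> {x. x \<bullet> ?e \<le> t}"
    unfolding comp by (rule set_eqI) (use t in \<open>auto simp: coords axis_def\<close>)
  also have "?I (cbox 0 1 \<inter> {x. x \<bullet> ?e \<ge> t}) + ?I (cbox 0 1 \<inter> {x. x \<bullet> ?e \<le> t}) = ?I (cbox 0 1)"
    using integral_split[OF int e, of 0 1 t] by simp
  finally show ?thesis .
qed

text \<open>
  The integral of the derivative over one period of a line in direction \<open>i\<close> vanishes. Since the
  integral over the cube does not change under shifts in that direction, it can be replaced by its
  average over such shifts, and exchanging the integrals leaves an integral over lines inside.
\<close>

lemma cube_integral_partial_deriv:
  fixes \<psi> :: "real^'n \<Rightarrow> complex"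
  assumes diff: "\<psi> differentiable_on UNIV" and per: "\<And>k x. \<psi> (x + real_vec k) = \<psi> x"
    and cont: "continuous_on UNIV (partial_deriv i \<psi>)"
  shows "integral (cbox 0 1) (partial_deriv i \<psi>) = 0"
proof -
  let ?e = "axis i 1 :: real^'n" and ?D = "partial_deriv i \<psi>"
  have perD: "?D (x + real_vec k) = ?D x" for k x
    using iter_partial_periodic[OF per, of "[i]"] by simp
  have line: "integral {0..1} (\<lambda>t. ?D (x + t *\<^sub>R ?e)) = 0" for x
  proof -
    have "((\<lambda>t. ?D (x + t *\<^sub>R ?e)) has_integral (\<psi> (x + 1 *\<^sub>R ?e) - \<psi> (x + 0 *\<^sub>R ?e))) {0..1}"
      by (rule fundamental_theorem_of_calculus)
         (use diff in \<open>auto simp: differentiable_on_def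
            intro!: has_vector_derivative_at_within has_vector_derivative_partial_deriv\<close>)
    moreover have "\<psi> (x + ?e) = \<psi> x"
    proof -
      have "?e = real_vec (axis i 1)"
        by (simp add: real_vec_def axis_def vec_eq_iff)
      then show ?thesis by (simp add: per)
    qed
    ultimately show ?thesis by (simp add: integral_unique)
  qed
  have "integral (cbox 0 1) ?D = integral (cbox 0 (1::real)) (\<lambda>t. integral (cbox 0 1) ?D)"
    by simp
  also have "\<dots> = integral (cbox 0 (1::real)) (\<lambda>t. integral (cbox 0 1) (\<lambda>x. ?D (x + t *\<^sub>R ?e)))"
    by (rule integral_cong) (simp add: cube_integral_shift[OF cont perD])
  also have "\<dots> = integral (cbox 0 1) (\<lambda>x. integral (cbox 0 (1::real)) (\<lambda>t. ?D (x + t *\<^sub>R ?e)))"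
    by (rule integral_swap_continuous)
       (auto simp: case_prod_unfold intro!: continuous_intros continuous_on_compose2[OF cont])
  also have "\<dots> = 0"
    using line by simp
  finally show ?thesis .
qed

section \<open>Pairing with characters\<close>

text \<open>
  The bilinear pairing, without complex conjugation, of a function with \<open>e\<^sub>k\<close>: this is the
  Fourier coefficient of \<open>q\<close> at \<open>-k\<close>. It is the factor that multiplies \<open>u^(k)\<close> when a Fourier
  series is tested against \<open>q\<close>.
\<close>

definition torus_pairing :: "int^'n \<Rightarrow> (real^'n \<Rightarrow> complex) \<Rightarrow> complex" where
  "torus_pairing k q = integral (cbox 0 1) (\<lambda>x. fourier_char k x * q x)"

lemma continuous_fourier_char [continuous_intros]: "continuous_on S (fourier_char k)"
  by (rule test_functions_continuous) (rule fourier_char_test_function)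

lemma torus_pairing_cube:
  assumes "continuous_on UNIV q"
  shows "(\<lambda>x. fourier_char k x * q x) integrable_on cbox 0 1"
  by (intro integrable_continuous continuous_intros continuous_on_subset[OF assms]) simp

lemma distr_of_fourier_char:
  assumes "\<phi> \<in> test_functions"
  shows "distr_of (fourier_char k) \<phi> = torus_pairing k \<phi>"
  using assms unfolding distr_of_def torus_pairing_def
  by (simp add: torus_integral_eq continuous_intros test_functions_continuous)

lemma torus_pairing_partial_deriv:
  fixes \<phi> :: "real^'n \<Rightarrow> complex"
  assumes "\<phi> \<in> test_functions"
  shows "torus_pairing k (partial_deriv i \<phi>) = - deriv_symbol i k * torus_pairing k \<phi>"
proof -
  have diff: "\<phi> differentiable_on UNIV"
    using test_functions_differentiable[OF assms, of "[]"] by simp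
  have D: "partial_deriv i \<phi> \<in> test_functions"
    using iter_partial_test_functions[OF assms, of "[i]"] by simp
  have eq: "partial_deriv i (\<lambda>x. fourier_char k x * \<phi> x) =
      (\<lambda>x. fourier_char k x * partial_deriv i \<phi> x + deriv_symbol i k * (fourier_char k x * \<phi> x))"
    unfolding partial_deriv_mult[OF fourier_char_differentiable diff] partial_deriv_fourier_char
    by (simp add: mult_ac)
  have "integral (cbox 0 1) (partial_deriv i (\<lambda>x. fourier_char k x * \<phi> x)) = 0"
    by (rule cube_integral_partial_deriv)
       (auto simp: eq fourier_char_periodic test_functions_periodic[OF assms]
         intro!: differentiable_on_mult fourier_char_differentiable diff continuous_intros
           test_functions_continuous[OF assms] test_functions_continuous[OF D])
  also have "integral (cbox 0 1) (partial_deriv i (\<lambda>x. fourier_char k x * \<phi> x)) =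
      torus_pairing k (partial_deriv i \<phi>) + deriv_symbol i k * torus_pairing k \<phi>"
    unfolding eq torus_pairing_def
    by (subst integral_add)
       (auto intro!: torus_pairing_cube integrable_on_mult_right test_functions_continuous D assms)
  finally show ?thesis by (simp add: eq_neg_iff_add_eq_0)
qed

lemma deriv_symbol_eq_0 [simp]: "deriv_symbol i k = 0 \<longleftrightarrow> k $ i = 0"
  by (simp add: deriv_symbol_def)

lemma norm_deriv_symbol: "norm (deriv_symbol i k) = 2 * pi * \<bar>of_int (k $ i)\<bar>"
  by (simp add: deriv_symbol_def norm_mult)

text \<open>
  If \<open>k + l \<noteq> 0\<close>, the product of the two characters is the derivative of a periodic function,
  up to a nonzero factor.
\<close>

lemma torus_pairing_fourier_char:
  "torus_pairing k (fourier_char l) = (if l = - k then 1 else 0)"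
proof (cases "l = - k")
  case True
  then show ?thesis by (simp add: torus_pairing_def fourier_char_mult)
next
  case False
  then obtain i where i: "deriv_symbol i (k + l) \<noteq> 0"
    by (auto simp: vec_eq_iff add_eq_0_iff)
  have "torus_pairing 0 (fourier_char (k + l)) = 0"
    using torus_pairing_partial_deriv[OF fourier_char_test_function, of 0 i "k + l"] i
    by (simp add: partial_deriv_fourier_char torus_pairing_def deriv_symbol_def[of _ 0]
        integral_mult_right del: deriv_symbol_eq_0)
  moreover have "torus_pairing 0 (fourier_char (k + l)) = torus_pairing k (fourier_char l)"
    by (simp add: torus_pairing_def fourier_char_mult)
  ultimately show ?thesis using False by simp
qed

lemma torus_pairing_bound:
  fixes q :: "real^'n \<Rightarrow> complex"
  assumes "continuous_on UNIV q" "\<And>x. norm (q x) \<le> B"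
  shows "norm (torus_pairing k q) \<le> B"
proof -
  have "0 \<le> B" by (rule order_trans[OF norm_ge_zero assms(2)])
  then have "norm (torus_pairing k q) \<le> B * measure lborel (cbox 0 (1::real^'n))"
    unfolding torus_pairing_def
    by (rule Henstock_Kurzweil_Integration.integrable_bound) (auto intro!: torus_pairing_cube assms simp: norm_mult)
  then show ?thesis by simp
qed

section \<open>Rapid decay of the Fourier coefficients of test functions\<close>

text \<open>
  The sums of seminorms that control the continuity of distributions.
\<close>

definition test_seminorm :: "nat \<Rightarrow> (real^'n \<Rightarrow> complex) \<Rightarrow> real" where
  "test_seminorm N \<phi> = (\<Sum>js\<in>{js. length js \<le> N}. SUP x. norm (iter_partial js \<phi> x))"

lemma finite_multi_indices: "finite {js::'n::finite list. length js \<le> N}"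
  using finite_lists_length_le[of "UNIV::'n set" N] by simp

lemma exists_translate_unit_cube: "\<exists>k. x + real_vec k \<in> cbox 0 1"
proof
  show "x + real_vec (\<chi> i. - \<lfloor>x $ i\<rfloor>) \<in> cbox 0 1"
    unfolding mem_unit_cube real_vec_def
  proof
    fix i
    show "0 \<le> (x + (\<chi> i. real_of_int ((\<chi> i. - \<lfloor>x $ i\<rfloor>) $ i))) $ i \<and>
          (x + (\<chi> i. real_of_int ((\<chi> i. - \<lfloor>x $ i\<rfloor>) $ i))) $ i \<le> 1"
      by simp linarith
  qed
qed

lemma periodic_bounded:
  fixes q :: "real^'n \<Rightarrow> complex"
  assumes "continuous_on UNIV q" "\<And>k x. q (x + real_vec k) = q x"
  shows "bdd_above (range (\<lambda>x. norm (q x)))"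
proof -
  have "compact (q ` cbox 0 1)"
    by (intro compact_continuous_image compact_cbox continuous_on_subset[OF assms(1)]) simp
  then have "bounded (q ` cbox 0 1)" by (rule compact_imp_bounded)
  then obtain B where B: "\<And>x. x \<in> cbox 0 1 \<Longrightarrow> norm (q x) \<le> B"
    by (auto simp: bounded_iff)
  have "norm (q x) \<le> B" for x
    using exists_translate_unit_cube[of x] B assms(2) by metis
  then show ?thesis by (auto simp: bdd_above_def)
qed

lemma test_functions_bounded:
  "\<phi> \<in> test_functions \<Longrightarrow> bdd_above (range (\<lambda>x. norm (\<phi> x)))"
  by (rule periodic_bounded) (simp_all add: test_functions_continuous test_functions_periodic)

lemma norm_le_SUP_test_function:
  assumes "\<phi> \<in> test_functions" shows "norm (\<phi> x) \<le> (SUP x. norm (\<phi> x))"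
  by (rule cSUP_upper[OF _ test_functions_bounded[OF assms]]) simp

lemma norm_iter_partial_le_test_seminorm:
  assumes "\<phi> \<in> test_functions" "length js \<le> N"
  shows "norm (iter_partial js \<phi> x) \<le> test_seminorm N \<phi>"
proof -
  have nn: "0 \<le> (SUP x. norm (iter_partial ks \<phi> x))" for ks
    by (rule order_trans[OF norm_ge_zero norm_le_SUP_test_function])
       (rule iter_partial_test_functions[OF assms(1)])
  have "norm (iter_partial js \<phi> x) \<le> (SUP x. norm (iter_partial js \<phi> x))"
    by (intro norm_le_SUP_test_function iter_partial_test_functions assms)
  also have "\<dots> \<le> test_seminorm N \<phi>"
    unfolding test_seminorm_def
    by (rule member_le_sum) (use assms nn in \<open>auto simp: finite_multi_indices\<close>)
  finally show ?thesis .
qed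

lemma test_seminorm_nonneg: "\<phi> \<in> test_functions \<Longrightarrow> 0 \<le> test_seminorm N \<phi>"
  by (rule order_trans[OF norm_ge_zero norm_iter_partial_le_test_seminorm[of \<phi> "[]" N]]) simp_all

lemma torus_pairing_iter_partial:
  assumes "\<phi> \<in> test_functions"
  shows "torus_pairing k (iter_partial js \<phi>) = (\<Prod>j\<leftarrow>js. - deriv_symbol j k) * torus_pairing k \<phi>"
  by (induction js)
     (simp_all add: torus_pairing_partial_deriv iter_partial_test_functions assms)

lemma bracket_ge_1: "1 \<le> bracket k"
  by (simp add: bracket_def)

lemma bracket_pos [simp]: "0 < bracket k" and bracket_nonneg [simp]: "0 \<le> bracket k"
  using bracket_ge_1[of k] by linarith+

lemma bracket_nonzero [simp]: "bracket k \<noteq> 0"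
  using bracket_pos[of k] by linarith

lemma bracket_square: "(bracket (k::int^'n))\<^sup>2 = 1 + (\<Sum>i\<in>UNIV. (real_of_int (k $ i))\<^sup>2)"
proof -
  have "(norm (real_vec k))\<^sup>2 = (\<Sum>i\<in>UNIV. (real_of_int (k $ i))\<^sup>2)"
    by (simp add: norm_vec_def L2_set_def real_vec_def sum_nonneg)
  then show ?thesis
    by (simp add: bracket_def add_nonneg_nonneg sum_nonneg)
qed

text \<open>
  For the largest coordinate, \<open>1 + \<bar>k\<bar>\<^sup>2 \<le> 1 + n k\<^sub>i\<^sup>2 \<le> (1 + n) k\<^sub>i\<^sup>2\<close>, as \<open>k\<^sub>i\<^sup>2 \<ge> 1\<close>.
\<close>

lemma bracket_le_coordinate:
  fixes k :: "int^'n"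
  assumes "k \<noteq> 0"
  shows "\<exists>i. bracket k \<le> (1 + CARD('n)) * \<bar>real_of_int (k $ i)\<bar>"
proof -
  have "Max (range (\<lambda>i. \<bar>k $ i\<bar>)) \<in> range (\<lambda>i. \<bar>k $ i\<bar>)"
    by (rule Max_in) auto
  then obtain i where "Max (range (\<lambda>i. \<bar>k $ i\<bar>)) = \<bar>k $ i\<bar>" by (rule rangeE)
  then have i: "\<bar>k $ j\<bar> \<le> \<bar>k $ i\<bar>" for j
    by (metis Max_ge finite finite_imageI rangeI)
  have "k $ i \<noteq> 0"
    using assms i by (fastforce simp: vec_eq_iff)
  then have 1: "1 \<le> (real_of_int (k $ i))\<^sup>2"
  proof -
    have "0 < (k $ i)\<^sup>2" using \<open>k $ i \<noteq> 0\<close> by simp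
    then have "1 \<le> (k $ i)\<^sup>2" by linarith
    then have "real_of_int 1 \<le> real_of_int ((k $ i)\<^sup>2)" by (simp only: of_int_le_iff)
    then show ?thesis by simp
  qed
  have "(\<Sum>j\<in>UNIV. (real_of_int (k $ j))\<^sup>2) \<le> (\<Sum>j\<in>(UNIV::'n set). (real_of_int (k $ i))\<^sup>2)"
  proof (rule sum_mono)
    fix j
    have "\<bar>real_of_int (k $ j)\<bar> \<le> \<bar>real_of_int (k $ i)\<bar>"
      using i[of j] by linarith
    then show "(real_of_int (k $ j))\<^sup>2 \<le> (real_of_int (k $ i))\<^sup>2"
      by (simp only: abs_le_square_iff)
  qed
  then have "(bracket k)\<^sup>2 \<le> (1 + CARD('n)) * (real_of_int (k $ i))\<^sup>2"
    using 1 by (simp add: bracket_square algebra_simps)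
  also have "\<dots> \<le> (1 + CARD('n))\<^sup>2 * (real_of_int (k $ i))\<^sup>2"
    by (intro mult_right_mono) (auto simp: power2_eq_square)
  also have "\<dots> = ((1 + CARD('n)) * \<bar>real_of_int (k $ i)\<bar>)\<^sup>2"
    by (simp add: power_mult_distrib)
  finally show ?thesis
    by (intro exI[of _ i]) (rule power2_le_imp_le, auto)
qed

text \<open>
  Integrating by parts \<open>m\<close> times in the coordinate in which \<open>k\<close> is largest gains the factor
  \<open>\<bar>2\<pi>k\<^sub>i\<bar>\<^sup>m\<close>, which for \<open>k \<noteq> 0\<close> is comparable to \<open>\<langle>k\<rangle>\<^sup>m\<close>; only \<open>m\<close> derivatives are spent.
\<close>

lemma torus_pairing_decay:
  fixes \<phi> :: "real^'n \<Rightarrow> complex"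
  assumes \<phi>: "\<phi> \<in> test_functions"
  shows "bracket k ^ m * norm (torus_pairing k \<phi>) \<le> (1 + CARD('n)) ^ m * test_seminorm m \<phi>"
proof (cases "k = 0")
  case True
  have "norm (torus_pairing k \<phi>) \<le> test_seminorm m \<phi>"
    by (rule torus_pairing_bound)
       (use norm_iter_partial_le_test_seminorm[OF \<phi>, of "[]"] in \<open>auto simp: test_functions_continuous \<phi>\<close>)
  also have "\<dots> \<le> (1 + real CARD('n)) ^ m * test_seminorm m \<phi>"
    using mult_right_mono[OF one_le_power[of "1 + real CARD('n)" m] test_seminorm_nonneg[OF \<phi>, of m]]
    by simp
  finally show ?thesis using True by (simp add: bracket_def)
next
  case False
  then obtain i where i: "bracket k \<le> (1 + CARD('n)) * \<bar>real_of_int (k $ i)\<bar>"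
    using bracket_le_coordinate by blast
  have 1: "1 \<le> 2 * pi" using pi_gt3 by simp
  have "bracket k \<le> (1 + CARD('n)) * norm (deriv_symbol i k)"
    unfolding norm_deriv_symbol
    by (rule order_trans[OF i]) (use 1 mult_right_mono[OF 1, of "\<bar>real_of_int (k $ i)\<bar>"] in \<open>auto intro!: mult_left_mono\<close>)
  then have "bracket k ^ m \<le> ((1 + CARD('n)) * norm (deriv_symbol i k)) ^ m"
    by (rule power_mono) simp
  then have "bracket k ^ m * norm (torus_pairing k \<phi>) \<le>
      (1 + CARD('n)) ^ m * norm (torus_pairing k (iter_partial (replicate m i) \<phi>))"
    unfolding torus_pairing_iter_partial[OF \<phi>]
    by (simp add: norm_mult norm_power power_mult_distrib mult_right_mono flip: mult.assoc)
  also have "\<dots> \<le> (1 + CARD('n)) ^ m * test_seminorm m \<phi>"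
    by (intro mult_left_mono torus_pairing_bound norm_iter_partial_le_test_seminorm
        test_functions_continuous iter_partial_test_functions \<phi>) auto
  finally show ?thesis .
qed

lemma summable_inverse_square_int: "(\<lambda>j::int. 1 / (1 + (real_of_int j)\<^sup>2)) summable_on UNIV"
proof -
  let ?g = "\<lambda>j::int. 1 / (1 + (real_of_int j)\<^sup>2)"
  have "summable (\<lambda>n::nat. 1 / (real n)\<^sup>2)"
    using inverse_power_summable[of 2, where 'a=real] by (simp add: inverse_eq_divide)
  then have "summable (\<lambda>n::nat. 1 / (1 + (real n)\<^sup>2))"
  proof (rule summable_comparison_test'[where N = 1])
    fix n :: nat assume "n \<ge> 1"
    then have "1 / (1 + (real n)\<^sup>2) \<le> 1 / (real n)\<^sup>2"
      by (intro frac_le) auto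
    then show "norm (1 / (1 + (real n)\<^sup>2)) \<le> 1 / (real n)\<^sup>2"
      by (simp add: abs_of_nonneg add_nonneg_nonneg)
  qed
  then have s: "(\<lambda>n::nat. 1 / (1 + (real n)\<^sup>2)) summable_on UNIV"
    by (intro norm_summable_imp_summable_on) simp
  have 1: "?g summable_on range int"
    by (subst summable_on_reindex) (use s in \<open>auto simp: o_def\<close>)
  have 2: "?g summable_on range (\<lambda>n. - int n)"
    by (subst summable_on_reindex) (use s in \<open>auto simp: o_def inj_on_def\<close>)
  have "(UNIV :: int set) = range int \<union> range (\<lambda>n. - int n)"
    by (auto) (metis int_cases2 rangeI)
  then show ?thesis using summable_on_union[OF 1 2] by simp
qed

text \<open>
  The exponent \<open>2n\<close>, larger than necessary, allows a comparison with the product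
  \<open>\<Prod>\<^sub>i (1 + k\<^sub>i\<^sup>2)\<^sup>-\<^sup>1\<close>, whose sum factorises into sums over \<open>\<int>\<close>.
\<close>

lemma summable_bracket:
  "(\<lambda>k::int^'n. 1 / bracket k ^ (2 * CARD('n))) summable_on UNIV"
proof -
  let ?g = "\<lambda>j::int. 1 / (1 + (real_of_int j)\<^sup>2)"
  let ?S = "\<Sum>\<^sub>\<infinity>j. ?g j"
  have g0: "0 \<le> ?g j" for j by (simp add: add_nonneg_nonneg)
  have le: "1 / bracket k ^ (2 * CARD('n)) \<le> (\<Prod>i\<in>UNIV. ?g (k $ i))" for k :: "int^'n"
  proof -
    have "(\<Prod>i\<in>UNIV. 1 + (real_of_int (k $ i))\<^sup>2) \<le> (\<Prod>i\<in>(UNIV::'n set). (bracket k)\<^sup>2)"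
      by (rule prod_mono) (auto simp: bracket_square intro!: add_nonneg_nonneg member_le_sum)
    then have "(\<Prod>i\<in>UNIV. 1 + (real_of_int (k $ i))\<^sup>2) \<le> bracket k ^ (2 * CARD('n))"
      by (simp add: power_mult)
    moreover have "0 < (\<Prod>i\<in>UNIV. 1 + (real_of_int (k $ i))\<^sup>2)"
      by (intro prod_pos) (simp add: add_pos_nonneg)
    ultimately show ?thesis
      by (simp add: prod_dividef divide_left_mono)
  qed
  have "(\<lambda>k::int^'n. \<Prod>i\<in>UNIV. ?g (k $ i)) summable_on UNIV"
  proof (rule nonneg_bdd_above_summable_on)
    show "bdd_above (sum (\<lambda>k::int^'n. \<Prod>i\<in>UNIV. ?g (k $ i)) ` {F. F \<subseteq> UNIV \<and> finite F})"
    proof (rule bdd_aboveI2)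
      fix F :: "(int^'n) set" assume "F \<in> {F. F \<subseteq> UNIV \<and> finite F}"
      then have F: "finite F" by simp
      \<comment> \<open>All coordinates that occur in \<open>F\<close>, so that \<open>F\<close> lies in a finite product set.\<close>
      define J where "J = (\<Union>i. (\<lambda>k. k $ i) ` F)"
      have J: "finite J" using F by (auto simp: J_def)
      have "(\<Sum>k\<in>F. \<Prod>i\<in>UNIV. ?g (k $ i)) = (\<Sum>f\<in>vec_nth ` F. \<Prod>i\<in>UNIV. ?g (f i))"
        by (subst sum.reindex) (auto simp: inj_on_def vec_nth_inject)
      also have "\<dots> \<le> (\<Sum>f\<in>PiE (UNIV::'n set) (\<lambda>_. J). \<Prod>i\<in>UNIV. ?g (f i))"
        by (rule sum_mono2) (auto intro!: prod_nonneg finite_PiE simp: J, auto simp: J_def)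
      also have "\<dots> = (\<Prod>i\<in>(UNIV::'n set). \<Sum>j\<in>J. ?g j)"
        by (rule prod_sum_PiE[symmetric]) (auto simp: J)
      also have "\<dots> \<le> (\<Prod>i\<in>(UNIV::'n set). ?S)"
        by (intro prod_mono conjI sum_nonneg g0 finite_sum_le_infsum summable_inverse_square_int J) auto
      finally show "(\<Sum>k\<in>F. \<Prod>i\<in>UNIV. ?g (k $ i)) \<le> (\<Prod>i\<in>(UNIV::'n set). ?S)" .
    qed
  qed (auto intro!: prod_nonneg)
  then show ?thesis
    by (rule summable_on_comparison_test) (use le in auto)
qed

section \<open>Uniqueness of Fourier coefficients\<close>

text \<open>
  Together with \<open>null_preserving\<close> this replaces a calculus of trigonometric polynomials. The
  functions that preserve null functions under multiplication form an algebra; it contains the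
  characters, hence every polynomial in \<open>cos (2\<pi>x\<^sub>i)\<close> and \<open>sin (2\<pi>x\<^sub>i)\<close>.
\<close>

definition null_function :: "(real^'n \<Rightarrow> complex) \<Rightarrow> bool" where
  "null_function q \<longleftrightarrow> continuous_on UNIV q \<and> (\<forall>k. torus_pairing k q = 0)"

definition null_preserving :: "(real^'n \<Rightarrow> complex) \<Rightarrow> bool" where
  "null_preserving h \<longleftrightarrow>
     continuous_on UNIV h \<and> (\<forall>q. null_function q \<longrightarrow> null_function (\<lambda>x. h x * q x))"

lemma torus_pairing_add:
  assumes "continuous_on UNIV f" "continuous_on UNIV g"
  shows "torus_pairing k (\<lambda>x. f x + g x) = torus_pairing k f + torus_pairing k g"
  unfolding torus_pairing_def
  by (simp add: distrib_left integral_add torus_pairing_cube assms)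

lemma torus_pairing_cmult: "torus_pairing k (\<lambda>x. c * f x) = c * torus_pairing k f"
proof -
  have "torus_pairing k (\<lambda>x. c * f x) = integral (cbox 0 1) (\<lambda>x. c * (fourier_char k x * f x))"
    by (simp add: torus_pairing_def mult.left_commute)
  then show ?thesis by (simp add: torus_pairing_def integral_mult_right)
qed

lemma null_function_add:
  "null_function f \<Longrightarrow> null_function g \<Longrightarrow> null_function (\<lambda>x. f x + g x)"
  by (simp add: null_function_def torus_pairing_add continuous_on_add)

lemma null_function_cmult: "null_function f \<Longrightarrow> null_function (\<lambda>x. c * f x)"
  by (simp add: null_function_def torus_pairing_cmult continuous_on_mult_left)

text \<open>
  Multiplication by a character translates the coefficients.
\<close>

lemma null_preserving_fourier_char: "null_preserving (fourier_char l)"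
proof -
  have "torus_pairing k (\<lambda>x. fourier_char l x * q x) = torus_pairing (k + l) q" for k q
    by (simp add: torus_pairing_def fourier_char_mult flip: mult.assoc)
  then show ?thesis
    by (simp add: null_preserving_def null_function_def continuous_on_mult continuous_fourier_char)
qed

lemma null_preserving_const: "null_preserving (\<lambda>x. c)"
  by (simp add: null_preserving_def null_function_cmult)

lemma null_preserving_add:
  "null_preserving g \<Longrightarrow> null_preserving h \<Longrightarrow> null_preserving (\<lambda>x. g x + h x)"
  by (simp add: null_preserving_def null_function_add continuous_on_add distrib_right)

lemma null_preserving_mult:
  "null_preserving g \<Longrightarrow> null_preserving h \<Longrightarrow> null_preserving (\<lambda>x. g x * h x)"
  by (simp add: null_preserving_def continuous_on_mult mult.assoc)

lemma null_preserving_sum: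
  "(\<And>i. i \<in> F \<Longrightarrow> null_preserving (h i)) \<Longrightarrow> null_preserving (\<lambda>x. \<Sum>i\<in>F. h i x)"
  by (induction F rule: infinite_finite_induct)
     (simp_all add: null_preserving_const null_preserving_add)

text \<open>
  Identifies the torus with a compact subset of a Euclidean space, so that the Stone-Weierstrass
  theorem for compact sets applies to periodic functions.
\<close>

definition torus_embedding :: "real^'n \<Rightarrow> (real^'n) \<times> (real^'n)" where
  "torus_embedding x = ((\<chi> i. cos (2 * pi * x $ i)), (\<chi> i. sin (2 * pi * x $ i)))"

lemma fourier_char_axis: "fourier_char (axis i 1) x = cis (2 * pi * x $ i)"
  "fourier_char (- axis i 1) x = cis (- (2 * pi * x $ i))"
proof -
  have "real_vec (axis i 1) = axis i 1"
    by (simp add: real_vec_def axis_def vec_eq_iff)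
  then show "fourier_char (axis i 1) x = cis (2 * pi * x $ i)"
    "fourier_char (- axis i 1) x = cis (- (2 * pi * x $ i))"
    by (simp_all add: fourier_char_def inner_axis')
qed

lemma null_preserving_cos: "null_preserving (\<lambda>x. of_real (cos (2 * pi * x $ i)))"
proof -
  have "(\<lambda>x. of_real (cos (2 * pi * x $ i)) :: complex) =
     (\<lambda>x. (1/2) * (fourier_char (axis i 1) x + fourier_char (- axis i 1) x))"
    by (simp add: fourier_char_axis complex_eq_iff fun_eq_iff)
  then show ?thesis
    by (simp only: null_preserving_add null_preserving_mult null_preserving_const null_preserving_fourier_char)
qed

lemma null_preserving_sin: "null_preserving (\<lambda>x. of_real (sin (2 * pi * x $ i)))"
proof -
  have "(\<lambda>x. of_real (sin (2 * pi * x $ i)) :: complex) =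
     (\<lambda>x. (- \<i>/2) * (fourier_char (axis i 1) x + (- 1) * fourier_char (- axis i 1) x))"
    by (simp add: fourier_char_axis complex_eq_iff fun_eq_iff)
  then show ?thesis
    by (simp only: null_preserving_add null_preserving_mult null_preserving_const null_preserving_fourier_char)
qed

lemma null_preserving_polynomial:
  fixes p :: "(real^'n) \<times> (real^'n) \<Rightarrow> real"
  assumes "real_polynomial_function p"
  shows "null_preserving (\<lambda>x. of_real (p (torus_embedding x)))"
  using assms
proof induction
  case (linear f)
  interpret bounded_linear f by fact
  have "f (torus_embedding x) = (\<Sum>i\<in>UNIV. cos (2 * pi * x $ i) * f (axis i 1, 0))
          + (\<Sum>i\<in>UNIV. sin (2 * pi * x $ i) * f (0, axis i 1))" for x
  proof -
    have "torus_embedding x = (\<Sum>i\<in>UNIV. cos (2 * pi * x $ i) *\<^sub>R (axis i 1, 0))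
            + (\<Sum>i\<in>UNIV. sin (2 * pi * x $ i) *\<^sub>R (0, axis i 1))"
      by (simp add: torus_embedding_def prod_eq_iff fst_sum snd_sum vec_eq_iff
          axis_def if_distrib sum.delta cong: if_cong)
    then show ?thesis by (simp only: add sum scaleR real_scaleR_def)
  qed
  then show ?case
    by (simp add: null_preserving_add null_preserving_sum null_preserving_mult
        null_preserving_const null_preserving_cos null_preserving_sin)
qed (simp_all add: null_preserving_const null_preserving_add null_preserving_mult)

lemma torus_embedding_eqD:
  assumes "torus_embedding x = torus_embedding y"
  shows "\<exists>k. x = y + real_vec k"
proof -
  have "\<exists>m::int. x $ i = y $ i + m" for i
  proof -
    have "sin (2 * pi * x $ i) = sin (2 * pi * y $ i) \<and> cos (2 * pi * x $ i) = cos (2 * pi * y $ i)"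
      using assms by (simp add: torus_embedding_def vec_eq_iff)
    then obtain m :: int where "2 * pi * x $ i = 2 * pi * y $ i + 2 * pi * m"
      unfolding sin_cos_eq_iff by blast
    then have "2 * pi * x $ i = 2 * pi * (y $ i + m)" by (simp add: distrib_left)
    then show ?thesis by auto
  qed
  then obtain m :: "'a \<Rightarrow> int" where "\<And>i. x $ i = y $ i + m i" by metis
  then have "x = y + real_vec (\<chi> i. m i)" by (simp add: vec_eq_iff real_vec_def)
  then show ?thesis by blast
qed

lemma torus_embedding_periodic: "torus_embedding (x + real_vec k) = torus_embedding x"
proof -
  have "2 * pi * (x + real_vec k) $ i = 2 * pi * x $ i + 2 * pi * real_of_int (k $ i)" for i
    by (simp add: real_vec_def distrib_left)
  then have "sin (2 * pi * (x + real_vec k) $ i) = sin (2 * pi * x $ i) \<and>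
      cos (2 * pi * (x + real_vec k) $ i) = cos (2 * pi * x $ i)" for i
    unfolding sin_cos_eq_iff by blast
  then show ?thesis by (simp only: torus_embedding_def)
qed

lemma continuous_torus_embedding: "continuous_on S torus_embedding"
  unfolding torus_embedding_def by (intro continuous_intros)

text \<open>
  A periodic function factors through the embedded torus. The factor is continuous because the
  cube is compact, which makes the embedding restricted to the cube a quotient map.
\<close>

lemma approximate_periodic_by_polynomial:
  fixes r :: "real^'n \<Rightarrow> real"
  assumes cont: "continuous_on UNIV r" and per: "\<And>k x. r (x + real_vec k) = r x" and "0 < e"
  obtains p where "real_polynomial_function p" "\<And>x. \<bar>r x - p (torus_embedding x)\<bar> < e"
proof -
  let ?K = "cbox 0 (1::real^'n)"
  let ?T = "torus_embedding ` ?K"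
  define g where "g y = r (SOME x. x \<in> ?K \<and> torus_embedding x = y)" for y
  have g: "g (torus_embedding x) = r x" if "x \<in> ?K" for x
  proof -
    let ?x = "SOME z. z \<in> ?K \<and> torus_embedding z = torus_embedding x"
    have "?x \<in> ?K \<and> torus_embedding ?x = torus_embedding x"
      by (rule someI[of _ x]) (simp add: that)
    then obtain k where "?x = x + real_vec k" using torus_embedding_eqD by blast
    then show ?thesis by (simp add: g_def per)
  qed
  have T: "compact ?T"
    by (intro compact_continuous_image continuous_torus_embedding compact_cbox)
  have "quotient_map (top_of_set ?K) (top_of_set ?T) torus_embedding"
    by (rule T1_Spaces.continuous_imp_quotient_map)
       (auto simp: continuous_torus_embedding Hausdorff_space_subtopology compact_space_subtopology)
  moreover have "continuous_map (top_of_set ?K) euclidean (g \<circ> torus_embedding)"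
    unfolding continuous_map_iff_continuous
    by (rule continuous_on_eq[OF continuous_on_subset[OF cont]]) (auto simp: g)
  ultimately have "continuous_map (top_of_set ?T) euclidean g"
    by (rule continuous_compose_quotient_map)
  then have "continuous_on ?T g" by simp
  from Stone_Weierstrass_real_polynomial_function[OF T this \<open>0 < e\<close>]
  obtain p where p: "real_polynomial_function p" "\<And>y. y \<in> ?T \<Longrightarrow> \<bar>g y - p y\<bar> < e"
    by blast
  have "\<bar>r x - p (torus_embedding x)\<bar> < e" for x
  proof -
    obtain k where k: "x + real_vec k \<in> ?K" using exists_translate_unit_cube by blast
    show ?thesis
      using p(2)[OF imageI[OF k]] unfolding g[OF k] by (simp add: per torus_embedding_periodic)
  qed
  with p(1) that show ?thesis by blast
qed

text \<open>
  A null function is orthogonal to the approximating polynomials of any continuous periodic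
  function, hence to that function.
\<close>

lemma null_function_orthogonal:
  fixes q :: "real^'n \<Rightarrow> complex" and r :: "real^'n \<Rightarrow> real"
  assumes null: "null_function q" and perq: "\<And>k x. q (x + real_vec k) = q x"
    and cont: "continuous_on UNIV r" and per: "\<And>k x. r (x + real_vec k) = r x"
  shows "torus_pairing 0 (\<lambda>x. of_real (r x) * q x) = 0"
proof -
  have contq: "continuous_on UNIV q" using null by (simp add: null_function_def)
  obtain B where B: "\<And>x. norm (q x) \<le> B"
    using periodic_bounded[OF contq perq] by (auto simp: bdd_above_def)
  have B0: "0 \<le> B" by (rule order_trans[OF norm_ge_zero B])
  have "norm (torus_pairing 0 (\<lambda>x. of_real (r x) * q x)) \<le> 0 + e" if "e > 0" for e
  proof -
    \<comment> \<open>Adding \<open>1\<close> keeps the divisor positive even if \<open>B = 0\<close>.\<close>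
    define e' where "e' = e / (B + 1)"
    have e': "e' > 0" using that B0 by (simp add: e'_def)
    obtain p where p: "real_polynomial_function p" "\<And>x. \<bar>r x - p (torus_embedding x)\<bar> < e'"
      using approximate_periodic_by_polynomial[OF cont per e'] by blast
    let ?P = "\<lambda>x. of_real (p (torus_embedding x)) :: complex"
    have P: "null_preserving ?P" by (rule null_preserving_polynomial[OF p(1)])
    have contP: "continuous_on UNIV ?P" using P by (simp add: null_preserving_def)
    have PQ: "null_function (\<lambda>x. ?P x * q x)" using P null by (simp add: null_preserving_def)
    have "torus_pairing 0 (\<lambda>x. of_real (r x) * q x) =
        torus_pairing 0 (\<lambda>x. (of_real (r x) - ?P x) * q x + ?P x * q x)"
      by (simp add: left_diff_distrib)
    also have "\<dots> = torus_pairing 0 (\<lambda>x. (of_real (r x) - ?P x) * q x)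
        + torus_pairing 0 (\<lambda>x. ?P x * q x)"
      by (intro torus_pairing_add continuous_intros cont contP contq)
    also have "torus_pairing 0 (\<lambda>x. ?P x * q x) = 0"
      using PQ by (simp add: null_function_def)
    finally have "norm (torus_pairing 0 (\<lambda>x. of_real (r x) * q x)) =
        norm (torus_pairing 0 (\<lambda>x. (of_real (r x) - ?P x) * q x))" by simp
    also have "\<dots> \<le> e' * B"
    proof (rule torus_pairing_bound)
      show "continuous_on UNIV (\<lambda>x. (of_real (r x) - ?P x) * q x)"
        by (intro continuous_intros cont contP contq)
      fix x
      have "norm (of_real (r x) - ?P x) \<le> e'"
        using p(2)[of x] by (simp flip: of_real_diff)
      then show "norm ((of_real (r x) - ?P x) * q x) \<le> e' * B"
        unfolding norm_mult using e' by (intro mult_mono B) auto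
    qed
    also have "\<dots> \<le> e" using that B0 by (simp add: e'_def field_simps)
    finally show ?thesis by simp
  qed
  then have "norm (torus_pairing 0 (\<lambda>x. of_real (r x) * q x)) \<le> 0"
    by (rule field_le_epsilon)
  then show ?thesis by simp
qed

text \<open>
  A function with vanishing coefficients is orthogonal to its own real and imaginary part, so
  \<open>\<integral>\<bar>q\<bar>\<^sup>2 = 0\<close>.
\<close>

proposition fourier_uniqueness:
  fixes q :: "real^'n \<Rightarrow> complex"
  assumes cont: "continuous_on UNIV q" and per: "\<And>k x. q (x + real_vec k) = q x"
    and zero: "\<And>k. torus_pairing k q = 0"
  shows "q x = 0"
proof -
  have null: "null_function q" using cont zero by (simp add: null_function_def)
  have cR: "continuous_on UNIV (\<lambda>x. Re (q x))" "continuous_on UNIV (\<lambda>x. Im (q x))"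
    by (intro continuous_intros cont)+
  have "torus_pairing 0 (\<lambda>x. of_real (Re (q x)) * q x) = 0"
       "torus_pairing 0 (\<lambda>x. of_real (Im (q x)) * q x) = 0"
    by (rule null_function_orthogonal[OF null per cR(1)], simp add: per)
       (rule null_function_orthogonal[OF null per cR(2)], simp add: per)
  moreover have "continuous_on UNIV (\<lambda>x. of_real (Re (q x)) * q x)"
      "continuous_on UNIV (\<lambda>x. (- \<i>) * (of_real (Im (q x)) * q x))"
    by (intro continuous_intros cR cont)+
  ultimately have "torus_pairing 0 (\<lambda>x. of_real (Re (q x)) * q x + (- \<i>) * (of_real (Im (q x)) * q x)) = 0"
    by (simp only: torus_pairing_add torus_pairing_cmult mult_zero_right add_0_right)
  \<comment> \<open>The combination is \<open>cnj q \<cdot> q\<close>.\<close>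
  also have "(\<lambda>x. of_real (Re (q x)) * q x + (- \<i>) * (of_real (Im (q x)) * q x)) =
      (\<lambda>x. of_real ((norm (q x))\<^sup>2))"
    by (auto simp: fun_eq_iff complex_eq_iff cmod_power2) (simp_all add: power2_eq_square)
  finally have "integral (cbox 0 1) (\<lambda>x. of_real ((norm (q x))\<^sup>2) :: complex) = 0"
    by (simp add: torus_pairing_def)
  moreover have int: "(\<lambda>x. (norm (q x))\<^sup>2) integrable_on cbox 0 1"
    by (intro integrable_continuous continuous_intros continuous_on_subset[OF cont]) simp
  have "((\<lambda>x. of_real ((norm (q x))\<^sup>2) :: complex) has_integral
      of_real (integral (cbox 0 1) (\<lambda>x. (norm (q x))\<^sup>2))) (cbox 0 1)"
    by (rule has_integral_of_real) (rule integrable_integral[OF int])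
  ultimately have "integral (cbox 0 1) (\<lambda>x. (norm (q x))\<^sup>2) = 0"
    by (simp add: integral_unique)
  then have hi: "((\<lambda>x. (norm (q x))\<^sup>2) has_integral 0) (cbox 0 1)"
    using integrable_integral[OF int] by simp
  obtain k where k: "x + real_vec k \<in> cbox 0 1" using exists_translate_unit_cube by blast
  have "(norm (q (x + real_vec k)))\<^sup>2 = 0"
    by (rule has_integral_0_cbox_imp_0[OF _ _ hi _ k])
       (auto intro!: continuous_intros continuous_on_subset[OF cont] simp: interval_eq_empty_cart)
  then show ?thesis by (simp add: per)
qed

section \<open>Fourier inversion for test functions\<close>

definition partial_fourier_sum :: "(int^'n) set \<Rightarrow> (real^'n \<Rightarrow> complex) \<Rightarrow> real^'n \<Rightarrow> complex" where
  "partial_fourier_sum F \<phi> x = (\<Sum>k\<in>F. torus_pairing k \<phi> * fourier_char (- k) x)"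

lemma summable_torus_pairing:
  fixes \<phi> :: "real^'n \<Rightarrow> complex"
  assumes "\<phi> \<in> test_functions"
  shows "(\<lambda>k. norm (torus_pairing k \<phi>)) summable_on UNIV"
proof -
  let ?m = "2 * CARD('n)" and ?K = "(1 + CARD('n)) ^ (2 * CARD('n)) * test_seminorm (2 * CARD('n)) \<phi>"
  have "norm (torus_pairing k \<phi>) \<le> ?K * (1 / bracket k ^ ?m)" for k
    using torus_pairing_decay[OF assms, of k ?m] by (simp add: field_simps)
  then show ?thesis
    by (intro summable_on_comparison_test[OF summable_on_cmult_right[OF summable_bracket, of ?K]]) auto
qed

lemma torus_pairing_sum:
  "(\<And>k. k \<in> F \<Longrightarrow> continuous_on UNIV (f k)) \<Longrightarrow>
     torus_pairing l (\<lambda>x. \<Sum>k\<in>F. f k x) = (\<Sum>k\<in>F. torus_pairing l (f k))"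
proof (induction F rule: infinite_finite_induct)
  case (insert k F)
  then show ?case by (simp add: torus_pairing_add continuous_on_sum)
qed (simp_all add: torus_pairing_def)

lemma torus_pairing_partial_fourier_sum:
  assumes "finite F"
  shows "torus_pairing l (partial_fourier_sum F \<phi>) = (if l \<in> F then torus_pairing l \<phi> else 0)"
  unfolding partial_fourier_sum_def[abs_def]
  by (subst torus_pairing_sum)
     (auto intro!: continuous_intros
       simp: torus_pairing_cmult torus_pairing_fourier_char assms if_distrib sum.delta cong: if_cong)

lemma continuous_partial_fourier_sum: "continuous_on S (partial_fourier_sum F \<phi>)"
  unfolding partial_fourier_sum_def[abs_def] by (intro continuous_intros)

text \<open>
  The Fourier series converges uniformly by the decay of the coefficients. Pairing with
  characters is continuous under uniform limits, so the sum has the same coefficients as \<open>\<phi>\<close> and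
  uniqueness identifies the two.
\<close>

lemma fourier_inversion_uniform:
  fixes \<phi> :: "real^'n \<Rightarrow> complex"
  assumes \<phi>: "\<phi> \<in> test_functions"
  shows "uniform_limit UNIV (\<lambda>F. partial_fourier_sum F \<phi>) \<phi> (finite_subsets_at_top UNIV)"
proof -
  define h where "h x = (\<Sum>\<^sub>\<infinity>k. torus_pairing k \<phi> * fourier_char (- k) x)" for x
  have lim: "uniform_limit UNIV (\<lambda>F. partial_fourier_sum F \<phi>) h (finite_subsets_at_top UNIV)"
    unfolding partial_fourier_sum_def[abs_def] h_def[abs_def]
    by (rule Weierstrass_m_test_general[OF _ summable_torus_pairing[OF \<phi>]]) (simp add: norm_mult)
  have conth: "continuous_on UNIV h"
    by (rule uniform_limit_theorem[OF _ lim]) (auto simp: continuous_partial_fourier_sum)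
  have contphi: "continuous_on UNIV \<phi>" by (rule test_functions_continuous[OF \<phi>])
  have perh: "h (x + real_vec k) = h x" for x k
    by (simp add: h_def fourier_char_periodic)
  have sub: "torus_pairing l (\<lambda>x. f x + (- 1) * g x) = torus_pairing l f - torus_pairing l g"
    if "continuous_on UNIV f" "continuous_on UNIV g" for l and f g :: "real^'n \<Rightarrow> complex"
    by (subst torus_pairing_add) (simp_all add: torus_pairing_cmult[of l "-1", simplified] continuous_on_minus that)
  have pair: "torus_pairing l h = torus_pairing l \<phi>" for l
  proof -
    have "norm (torus_pairing l \<phi> - torus_pairing l h) \<le> 0 + e" if "e > 0" for e
    proof -
      have "\<forall>\<^sub>F F in finite_subsets_at_top UNIV. finite F \<and> l \<in> F"
        unfolding eventually_finite_subsets_at_top by (intro exI[of _ "{l}"]) auto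
      then have "\<forall>\<^sub>F F in finite_subsets_at_top UNIV. (finite F \<and> l \<in> F) \<and>
              (\<forall>x\<in>UNIV. dist (partial_fourier_sum F \<phi> x) (h x) < e)"
        by (rule eventually_conj[OF _ uniform_limitD[OF lim that]])
      from eventually_happens'[OF finite_subsets_at_top_neq_bot this]
      obtain F where F: "l \<in> F" "finite F" "\<And>x. dist (partial_fourier_sum F \<phi> x) (h x) < e"
        by blast
      have "torus_pairing l \<phi> - torus_pairing l h =
          torus_pairing l (\<lambda>x. partial_fourier_sum F \<phi> x + (- 1) * h x)"
        by (subst sub) (simp_all add: continuous_partial_fourier_sum conth torus_pairing_partial_fourier_sum F)
      also have "norm \<dots> \<le> e"
        by (rule torus_pairing_bound)
           (use F(3) in \<open>auto intro!: continuous_intros continuous_partial_fourier_sum conth less_imp_le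
              simp: dist_norm\<close>)
      finally show ?thesis by simp
    qed
    then have "norm (torus_pairing l \<phi> - torus_pairing l h) \<le> 0" by (rule field_le_epsilon)
    then show ?thesis by simp
  qed
  have zero: "torus_pairing l (\<lambda>x. \<phi> x + (- 1) * h x) = 0" for l
    unfolding sub[OF contphi conth] by (simp add: pair)
  have "\<phi> x + (- 1) * h x = 0" for x
    by (rule fourier_uniqueness[OF _ _ zero])
       (auto intro!: continuous_intros contphi conth simp: perh test_functions_periodic[OF \<phi>])
  then have "h = \<phi>" by (auto simp: fun_eq_iff)
  with lim show ?thesis by simp
qed

lemma partial_fourier_sum_test_function: "partial_fourier_sum F \<phi> \<in> test_functions"
  unfolding partial_fourier_sum_def[abs_def]
  by (intro test_functions_sum test_functions_cmult fourier_char_test_function)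

lemma prod_list_deriv_symbol_uminus:
  "(\<Prod>j\<leftarrow>js. deriv_symbol j (- k)) = (\<Prod>j\<leftarrow>js. - deriv_symbol j k)"
  by (simp add: deriv_symbol_def)

text \<open>
  Since derivatives of test functions are test functions, this upgrades uniform convergence to
  convergence of all derivatives.
\<close>

lemma iter_partial_partial_fourier_sum:
  assumes "\<phi> \<in> test_functions"
  shows "iter_partial js (partial_fourier_sum F \<phi>) = partial_fourier_sum F (iter_partial js \<phi>)"
  unfolding partial_fourier_sum_def[abs_def]
  by (subst iter_partial_sum)
     (auto intro!: test_functions_cmult fourier_char_test_function sum.cong
       simp: iter_partial_cmult fourier_char_test_function iter_partial_fourier_char
         torus_pairing_iter_partial assms prod_list_deriv_symbol_uminus fun_eq_iff)

lemma fourier_inversion_test_seminorm: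
  fixes \<phi> :: "real^'n \<Rightarrow> complex"
  assumes \<phi>: "\<phi> \<in> test_functions"
  shows "((\<lambda>F. test_seminorm N (\<lambda>x. \<phi> x + (- 1) * partial_fourier_sum F \<phi> x)) \<longlongrightarrow> 0)
           (finite_subsets_at_top UNIV)"
proof (rule tendstoI)
  fix e :: real assume e: "e > 0"
  let ?J = "{js::'n list. length js \<le> N}"
  define e' where "e' = e / (card ?J + 1)"
  have e': "e' > 0" using e by (simp add: e'_def)
  have "\<forall>\<^sub>F F in finite_subsets_at_top UNIV. \<forall>js\<in>?J. \<forall>x\<in>UNIV.
      dist (partial_fourier_sum F (iter_partial js \<phi>) x) (iter_partial js \<phi> x) < e'"
    by (intro eventually_ball_finite finite_multi_indices ballI
        uniform_limitD[OF fourier_inversion_uniform e'] iter_partial_test_functions \<phi>)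
  then show "\<forall>\<^sub>F F in finite_subsets_at_top UNIV.
      dist (test_seminorm N (\<lambda>x. \<phi> x + (- 1) * partial_fourier_sum F \<phi> x)) 0 < e"
  proof eventually_elim
    case (elim F)
    let ?d = "\<lambda>x. \<phi> x + (- 1) * partial_fourier_sum F \<phi> x"
    have m: "(\<lambda>x. (- 1) * partial_fourier_sum F \<phi> x) \<in> test_functions"
      by (rule test_functions_cmult[OF partial_fourier_sum_test_function])
    have d: "?d \<in> test_functions" by (rule test_functions_add[OF \<phi> m])
    have "iter_partial js ?d =
        (\<lambda>x. iter_partial js \<phi> x + (- 1) * partial_fourier_sum F (iter_partial js \<phi>) x)" for js
      unfolding iter_partial_add[OF \<phi> m] iter_partial_cmult[OF partial_fourier_sum_test_function]
        iter_partial_partial_fourier_sum[OF \<phi>] ..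
    then have "test_seminorm N ?d \<le> (\<Sum>js\<in>?J. e')"
      unfolding test_seminorm_def
      using elim by (intro sum_mono cSUP_least) (auto simp: dist_norm norm_minus_commute less_imp_le)
    also have "\<dots> < e" using e by (simp add: e'_def field_simps)
    finally show ?case using test_seminorm_nonneg[OF d, of N] by simp
  qed
qed

section \<open>Distributions and their Fourier series\<close>

lemma distribution_cmult:
  "u \<in> distributions \<Longrightarrow> \<phi> \<in> test_functions \<Longrightarrow> u (\<lambda>x. c * \<phi> x) = c * u \<phi>"
  by (simp add: distributions_def)

lemma distribution_add:
  "u \<in> distributions \<Longrightarrow> \<phi> \<in> test_functions \<Longrightarrow> \<psi> \<in> test_functions \<Longrightarrow>
     u (\<lambda>x. \<phi> x + \<psi> x) = u \<phi> + u \<psi>"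
  by (simp add: distributions_def)

lemma distribution_sum:
  assumes "u \<in> distributions" "\<And>k. k \<in> F \<Longrightarrow> \<phi> k \<in> test_functions"
  shows "u (\<lambda>x. \<Sum>k\<in>F. \<phi> k x) = (\<Sum>k\<in>F. u (\<phi> k))"
  using assms(2)
proof (induction F rule: infinite_finite_induct)
  case (insert k F)
  then show ?case
    using assms(1) by (simp add: distributions_def test_functions_sum)
next
  have "u (\<lambda>x. 0) = 0"
    using distribution_cmult[OF assms(1) test_functions_zero, of 0] by simp
  then show "u (\<lambda>x. \<Sum>k\<in>{}. \<phi> k x) = (\<Sum>k\<in>{}. u (\<phi> k))" 
    "\<And>A. infinite A \<Longrightarrow> u (\<lambda>x. \<Sum>k\<in>A. \<phi> k x) = (\<Sum>k\<in>A. u (\<phi> k))" by simp_all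
qed

text \<open>
  A distribution may be applied termwise to the Fourier series of \<open>\<phi>\<close>, because that series
  converges in a seminorm controlling the distribution.
\<close>

proposition distribution_fourier_series:
  assumes u: "u \<in> distributions"
  shows "fourier_series (fourier_coeff u) = u"
proof
  fix \<phi> :: "real^'a \<Rightarrow> complex"
  show "fourier_series (fourier_coeff u) \<phi> = u \<phi>"
  proof (cases "\<phi> \<in> test_functions")
    case False
    then show ?thesis
      using u by (simp add: fourier_series_def distr_of_def distributions_def)
  next
    case \<phi>: True
    obtain C N where C: "\<And>\<psi>. \<psi> \<in> test_functions \<Longrightarrow> norm (u \<psi>) \<le> C * test_seminorm N \<psi>"
      using u unfolding distributions_def test_seminorm_def by blast
    let ?S = "\<lambda>F. partial_fourier_sum F \<phi>"
    have S: "(\<lambda>x. (- 1) * ?S F x) \<in> test_functions" for F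
      by (rule test_functions_cmult[OF partial_fourier_sum_test_function])
    have uS: "u (?S F) = (\<Sum>k\<in>F. fourier_coeff u k * distr_of (fourier_char k) \<phi>)" for F
      unfolding partial_fourier_sum_def[abs_def]
      by (subst distribution_sum[OF u])
         (auto intro!: test_functions_cmult fourier_char_test_function
           simp: distribution_cmult[OF u] fourier_char_test_function fourier_coeff_def
             distr_of_fourier_char \<phi> mult.commute)
    have bound: "norm (u \<phi> - u (?S F)) \<le> C * test_seminorm N (\<lambda>x. \<phi> x + (- 1) * ?S F x)" for F
    proof -
      have "u \<phi> - u (?S F) = u (\<lambda>x. \<phi> x + (- 1) * ?S F x)"
        unfolding distribution_add[OF u \<phi> S]
        by (subst distribution_cmult[OF u partial_fourier_sum_test_function]) simp
      then show ?thesis using C[OF test_functions_add[OF \<phi> S]] by metis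
    qed
    have "((\<lambda>F. u \<phi> - u (?S F)) \<longlongrightarrow> 0) (finite_subsets_at_top UNIV)"
      by (rule Lim_null_comparison[OF always_eventually[OF allI[OF bound]]
            tendsto_mult_right_zero[OF fourier_inversion_test_seminorm[OF \<phi>]]])
    then have "((\<lambda>F. u \<phi> - (u \<phi> - u (?S F))) \<longlongrightarrow> u \<phi> - 0) (finite_subsets_at_top UNIV)"
      by (intro tendsto_diff tendsto_const)
    then have "((\<lambda>k. fourier_coeff u k * distr_of (fourier_char k) \<phi>) has_sum u \<phi>) UNIV"
      by (simp add: has_sum_def uS)
    then show ?thesis by (simp add: fourier_series_def infsumI)
  qed
qed

text \<open>
  Tested against a character, the series has a single nonzero term.
\<close>

lemma fourier_coeff_fourier_series [simp]: "fourier_coeff (fourier_series a) k = a k"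
proof -
  have "fourier_coeff (fourier_series a) k = (\<Sum>\<^sub>\<infinity>j. a j * torus_pairing j (fourier_char (- k)))"
    by (simp add: fourier_coeff_def fourier_series_def distr_of_fourier_char fourier_char_test_function)
  also have "\<dots> = (\<Sum>\<^sub>\<infinity>j\<in>{k}. a j)"
    by (rule infsum_cong_neutral) (auto simp: torus_pairing_fourier_char)
  finally show ?thesis by simp
qed

text \<open>
  The growth of \<open>a\<close> is absorbed by the decay of the coefficients of the test function, with
  \<open>2n\<close> further derivatives to make the series summable.
\<close>

lemma fourier_series_distribution:
  fixes a :: "int^'n \<Rightarrow> complex"
  assumes a: "\<And>k. norm (a k) \<le> C * bracket k ^ N"
  shows "fourier_series a \<in> distributions"
proof -
  let ?m = "N + 2 * CARD('n)"
  let ?t = "\<lambda>k. 1 / bracket (k::int^'n) ^ (2 * CARD('n))"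
  define K where "K = C * (1 + CARD('n)) ^ ?m"
  \<comment> \<open>\<open>\<langle>0\<rangle> = 1\<close>, so the bound at \<open>k = 0\<close> shows that \<open>C\<close> is nonnegative.\<close>
  have C0: "0 \<le> C"
    using order_trans[OF norm_ge_zero a[of 0]] by (simp add: bracket_def)
  have term_le: "norm (a k * torus_pairing k \<phi>) \<le> K * test_seminorm ?m \<phi> * ?t k"
    if \<phi>: "\<phi> \<in> test_functions" for k \<phi>
  proof -
    have "norm (a k * torus_pairing k \<phi>) \<le> (C * bracket k ^ N) * norm (torus_pairing k \<phi>)"
      unfolding norm_mult by (intro mult_right_mono a) simp
    also have "\<dots> = C * (bracket k ^ ?m * norm (torus_pairing k \<phi>)) * ?t k"
      by (simp add: power_add field_simps less_imp_neq[OF bracket_pos, symmetric])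
    also have "\<dots> \<le> C * ((1 + CARD('n)) ^ ?m * test_seminorm ?m \<phi>) * ?t k"
      by (intro mult_right_mono mult_left_mono torus_pairing_decay \<phi> C0) simp
    finally show ?thesis by (simp add: K_def mult.assoc)
  qed
  have abs_sum: "(\<lambda>k. norm (a k * torus_pairing k \<phi>)) summable_on UNIV"
    if "\<phi> \<in> test_functions" for \<phi>
    by (rule summable_on_comparison_test[OF summable_on_cmult_right[OF summable_bracket]])
       (use term_le[OF that] in auto)
  have series: "fourier_series a \<phi> = (\<Sum>\<^sub>\<infinity>k. a k * torus_pairing k \<phi>)"
    if "\<phi> \<in> test_functions" for \<phi>
    using that by (simp add: fourier_series_def distr_of_fourier_char)
  show ?thesis
    unfolding distributions_def mem_Collect_eq
  proof (intro conjI ballI allI impI)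
    fix \<phi> \<psi> :: "real^'n \<Rightarrow> complex"
    assume \<phi>: "\<phi> \<in> test_functions" and \<psi>: "\<psi> \<in> test_functions"
    then have "torus_pairing k (\<lambda>x. \<phi> x + \<psi> x) = torus_pairing k \<phi> + torus_pairing k \<psi>" for k
      by (simp add: torus_pairing_add test_functions_continuous)
    then show "fourier_series a (\<lambda>x. \<phi> x + \<psi> x) = fourier_series a \<phi> + fourier_series a \<psi>"
      using \<phi> \<psi> by (simp add: series test_functions_add distrib_left infsum_add abs_summable_summable abs_sum)
  next
    fix c and \<phi> :: "real^'n \<Rightarrow> complex"
    assume \<phi>: "\<phi> \<in> test_functions"
    then show "fourier_series a (\<lambda>x. c * \<phi> x) = c * fourier_series a \<phi>"
      by (simp add: series test_functions_cmult torus_pairing_cmult mult.left_commute[of _ c] infsum_cmult_right')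
  next
    fix \<phi> :: "real^'n \<Rightarrow> complex"
    assume "\<phi> \<notin> test_functions"
    then show "fourier_series a \<phi> = 0" by (simp add: fourier_series_def distr_of_def)
  next
    have "norm (fourier_series a \<phi>) \<le> K * (\<Sum>\<^sub>\<infinity>k. ?t k) * test_seminorm ?m \<phi>"
      if \<phi>: "\<phi> \<in> test_functions" for \<phi>
    proof -
      have "norm (fourier_series a \<phi>) \<le> (\<Sum>\<^sub>\<infinity>k. norm (a k * torus_pairing k \<phi>))"
        unfolding series[OF \<phi>] by (rule norm_infsum_bound[OF abs_sum[OF \<phi>]])
      also have "\<dots> \<le> (\<Sum>\<^sub>\<infinity>k. K * test_seminorm ?m \<phi> * ?t k)"
        by (intro infsum_mono abs_sum \<phi> summable_on_cmult_right summable_bracket term_le)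
      also have "\<dots> = K * test_seminorm ?m \<phi> * (\<Sum>\<^sub>\<infinity>k. ?t k)"
        by (rule infsum_cmult_right')
      finally show ?thesis by (simp add: mult_ac)
    qed
    then show "\<exists>C N. \<forall>\<phi>\<in>test_functions. norm (fourier_series a \<phi>) \<le>
        C * (\<Sum>js\<in>{js. length js \<le> N}. SUP x. norm (iter_partial js \<phi> x))"
      unfolding test_seminorm_def by blast
  qed
qed

section \<open>The Radon transform on the Fourier side\<close>

lemma integral_unit_interval_cis:
  fixes m :: int
  shows "(\<integral>t. cis (2 * pi * m * t) \<partial>restrict_space lborel {0..1}) = (if m = 0 then 1 else 0)"
    (is "?I = _")
    and "integrable (restrict_space lborel {0..1}) (\<lambda>t. cis (2 * pi * m * t))"
proof -
  let ?f = "\<lambda>t::real. cis (2 * pi * m * t)"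
  have cont: "continuous_on {0..1} ?f" unfolding cis_conv_exp by (intro continuous_intros)
  have int: "set_integrable lborel {0..1} ?f"
    unfolding set_integrable_def
    using borel_integrable_compact[OF compact_Icc cont] by (simp add: indicator_scaleR_eq_if)
  then show "integrable (restrict_space lborel {0..1}) ?f"
    by (simp add: integrable_restrict_space set_integrable_def)
  have I: "?I = integral {0..1} ?f"
    using set_borel_integral_eq_integral(2)[OF int]
    by (simp add: integral_restrict_space set_lebesgue_integral_def)
  show "?I = (if m = 0 then 1 else 0)"
  proof (cases "m = 0")
    case True
    then show ?thesis unfolding I by simp
  next
    case False
    let ?c = "2 * pi * \<i> * m"
    have c: "?c \<noteq> 0" using False by simp
    have "((\<lambda>t::real. exp (?c * t) / ?c) has_vector_derivative ?f t) (at t within {0..1})" for t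
    proof -
      have "((\<lambda>z. exp (?c * z) / ?c) has_field_derivative exp (?c * t)) (at (of_real t))"
        using c by (auto intro!: derivative_eq_intros)
      from has_vector_derivative_real_field[OF this, of "{0..1}"]
      show ?thesis by (simp add: cis_conv_exp mult_ac o_def)
    qed
    then have "(?f has_integral (exp (?c * of_real 1) / ?c - exp (?c * of_real 0) / ?c)) {0..1}"
      by (intro fundamental_theorem_of_calculus) auto
    moreover have "exp ?c = 1"
      using exp_integer_2pi[of "of_int m"] by (simp add: mult_ac)
    ultimately show ?thesis
      unfolding I using False by (simp add: integral_unique)
  qed
qed

text \<open>
  Along \<open>v\<^sub>1, \<dots>, v\<^sub>d\<close> the character splits into a product of exponentials with the integer
  frequencies \<open>k \<cdot> v\<^sub>j\<close>, one for each integration variable.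
\<close>

lemma radon_along_fourier_char:
  fixes v :: "nat \<Rightarrow> int^'n"
  shows "radon_along d v (fourier_char k) =
    (\<lambda>x. (if \<forall>j<d. (\<Sum>i\<in>UNIV. k $ i * v j $ i) = 0 then 1 else 0) * fourier_char k x)"
proof
  fix x
  let ?M = "restrict_space lborel {0..1::real}"
  let ?m = "\<lambda>j. \<Sum>i\<in>UNIV. k $ i * v j $ i"
  have "finite_measure ?M"
    by (rule finite_measureI) (simp add: emeasure_restrict_space space_restrict_space)
  then interpret finite_measure ?M .
  interpret product_sigma_finite "\<lambda>j::nat. ?M"
    by unfold_locales
  have split: "fourier_char k (x + (\<Sum>j<d. t j *\<^sub>R real_vec (v j))) =
      fourier_char k x * (\<Prod>j<d. cis (2 * pi * ?m j * t j))" for t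
  proof -
    have "cis (\<Sum>j<d. \<theta> j) = (\<Prod>j<d. cis (\<theta> j))" for \<theta>
      by (induction d) (simp_all flip: cis_mult)
    moreover have "2 * pi * (real_vec k \<bullet> (x + (\<Sum>j<d. t j *\<^sub>R real_vec (v j)))) =
        2 * pi * (real_vec k \<bullet> x) + (\<Sum>j<d. 2 * pi * ?m j * t j)"
      by (simp only: inner_add_right inner_sum_right inner_scaleR_right inner_real_vec
          distrib_left sum_distrib_left mult_ac)
    ultimately show ?thesis
      by (simp only: fourier_char_def cis_mult[symmetric])
  qed
  have "radon_along d v (fourier_char k) x =
      fourier_char k x * (\<integral>t. (\<Prod>j<d. cis (2 * pi * ?m j * t j)) \<partial>Pi\<^sub>M {..<d} (\<lambda>_. ?M))"
    unfolding radon_along_def split by (rule integral_mult_right_zero)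
  also have "(\<integral>t. (\<Prod>j<d. cis (2 * pi * ?m j * t j)) \<partial>Pi\<^sub>M {..<d} (\<lambda>_. ?M)) =
      (\<Prod>j<d. \<integral>t. cis (2 * pi * ?m j * t) \<partial>?M)"
    by (rule product_integral_prod) (simp_all only: finite_lessThan integral_unit_interval_cis)
  also have "\<dots> = (\<Prod>j<d. if ?m j = 0 then 1 else 0)"
    by (simp only: integral_unit_interval_cis)
  also have "\<dots> = (if \<forall>j<d. ?m j = 0 then 1 else 0)"
    by (auto simp: prod_zero_iff intro!: prod.neutral)
  finally show "radon_along d v (fourier_char k) x =
      (if \<forall>j<d. ?m j = 0 then 1 else 0) * fourier_char k x"
    by (simp only: mult.commute)
qed

lemma clear_denominators:
  fixes b :: "rat^'n"
  shows "\<exists>c z. c \<noteq> 0 \<and> c *s b = rat_vec z"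
proof -
  have "\<exists>p q. q \<noteq> 0 \<and> b $ i = of_int p / of_int q" for i
  proof (cases "b $ i")
    case (Fract p q)
    then show ?thesis by (intro exI[of _ p] exI[of _ q]) (simp add: Fract_of_int_quotient)
  qed
  then obtain p q where pq: "\<And>i. q i \<noteq> 0" "\<And>i. b $ i = of_int (p i) / of_int (q i)"
    by metis
  \<comment> \<open>The product of all denominators; it cancels the \<open>i\<close>-th one and stays integral.\<close>
  let ?Q = "\<Prod>i\<in>UNIV. q i"
  have "of_int ?Q * b $ i = of_int (p i * (\<Prod>j\<in>UNIV - {i}. q j))" for i
    using pq(1)[of i] by (simp add: pq(2) prod.remove[of UNIV i])
  then have "of_int ?Q *s b = rat_vec (\<chi> i. p i * (\<Prod>j\<in>UNIV - {i}. q j))"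
    by (simp add: rat_vec_def vec_eq_iff)
  moreover have "(of_int ?Q :: rat) \<noteq> 0" using pq(1) by simp
  ultimately show ?thesis by blast
qed

text \<open>
  Multiplying the vectors of a rational basis by common denominators preserves their span. As
  \<open>d\<close> vectors spanning a space of dimension \<open>d\<close>, the new vectors are distinct and independent.
\<close>

lemma integer_basis_exists:
  fixes A :: "(rat^'n) set"
  assumes "A \<in> Gr d"
  shows "\<exists>v. integer_basis d A v"
proof -
  have sub: "vec.subspace A" and dim: "vec.dim A = d" using assms by (auto simp: Gr_def)
  obtain B where B: "B \<subseteq> A" "vec.independent B" "A \<subseteq> vec.span B" "card B = vec.dim A"
    using vec.basis_exists[of A] by blast
  have finB: "finite B" using vec.finiteI_independent[OF B(2)] .
  obtain c and z :: "rat^'n \<Rightarrow> int^'n" where cz: "\<And>b. c b \<noteq> 0" "\<And>b. c b *s b = rat_vec (z b)"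
    using clear_denominators by metis
  obtain e where e: "bij_betw e {..<d} B"
    using ex_bij_betw_nat_finite[OF finB] B(4) dim by (auto simp: atLeast0LessThan)
  define v where "v j = z (e j)" for j
  let ?S = "(\<lambda>j. rat_vec (v j)) ` {..<d}"
  have S: "?S = (\<lambda>b. c b *s b) ` B"
    using e by (auto simp: v_def cz(2) bij_betw_def)
  have span: "vec.span ?S = A"
    unfolding S vec.span_image_scale[OF finB cz(1)]
    using B(1,3) sub by (simp add: vec.span_minimal subset_antisym)
  have card_le: "card ?S \<le> d" using card_image_le[of "{..<d}"] by simp
  moreover have "d \<le> card ?S"
    using vec.dim_le_card[of A ?S] span dim by simp
  ultimately have card: "card ?S = d" by simp
  then have "inj_on (\<lambda>j. rat_vec (v j)) {..<d}"
    by (intro eq_card_imp_inj_on) auto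
  moreover have "vec.independent ?S"
    by (rule vec.card_le_dim_spanning[where V = A])
       (use span card dim vec.span_superset[of ?S] in auto)
  ultimately show ?thesis
    using span unfolding integer_basis_def by blast
qed

lemma orthogonal_to_iff_basis:
  assumes "integer_basis d A v"
  shows "orthogonal_to k A \<longleftrightarrow> (\<forall>j<d. (\<Sum>i\<in>UNIV. k $ i * v j $ i) = 0)"
proof -
  let ?P = "{a. (\<Sum>i\<in>UNIV. of_int (k $ i) * a $ i) = (0::rat)}"
  have A: "A = vec.span ((\<lambda>j. rat_vec (v j)) ` {..<d})"
    using assms by (simp add: integer_basis_def)
  have "vec.subspace ?P"
    by (rule vec.subspaceI)
       (simp_all add: distrib_left sum.distrib mult.left_commute flip: sum_distrib_left)
  then have "A \<subseteq> ?P \<longleftrightarrow> (\<lambda>j. rat_vec (v j)) ` {..<d} \<subseteq> ?P"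
    unfolding A by (meson order_trans vec.span_minimal vec.span_superset)
  moreover have "rat_vec (v j) \<in> ?P \<longleftrightarrow> (\<Sum>i\<in>UNIV. k $ i * v j $ i) = 0" for j
  proof -
    have "(\<Sum>i\<in>UNIV. of_int (k $ i) * rat_vec (v j) $ i) =
        (of_int (\<Sum>i\<in>UNIV. k $ i * v j $ i) :: rat)"
      by (simp add: rat_vec_def)
    then show ?thesis by (simp only: mem_Collect_eq of_int_eq_0_iff)
  qed
  ultimately show ?thesis
    by (auto simp: orthogonal_to_def subset_iff)
qed

lemma radon_test_fourier_char:
  assumes "A \<in> Gr d"
  shows "radon_test d A (fourier_char k) =
    (\<lambda>x. (if orthogonal_to k A then 1 else 0) * fourier_char k x)"
proof -
  have "integer_basis d A (SOME v. integer_basis d A v)"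
    by (rule someI_ex[OF integer_basis_exists[OF assms]])
  from orthogonal_to_iff_basis[OF this] show ?thesis
    unfolding radon_test_def radon_along_fourier_char by simp
qed

lemma orthogonal_to_uminus [simp]: "orthogonal_to (- k) A \<longleftrightarrow> orthogonal_to k A"
  by (simp add: orthogonal_to_def sum_negf)

lemma fourier_coeff_radon:
  assumes "u \<in> distributions" "A \<in> Gr d"
  shows "fourier_coeff (radon d u A) k = (if orthogonal_to k A then fourier_coeff u k else 0)"
proof -
  have "fourier_coeff (radon d u A) k = u (radon_test d A (fourier_char (- k)))"
    by (simp add: fourier_coeff_def radon_def fourier_char_test_function)
  then show ?thesis
    unfolding radon_test_fourier_char[OF assms(2)]
      distribution_cmult[OF assms(1) fourier_char_test_function]
    by (simp add: fourier_coeff_def)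
qed

section \<open>Sums of extended nonnegative reals\<close>

lemma ennreal_summable_on [simp]: "f summable_on S" for f :: "'a \<Rightarrow> ennreal"
  by (simp add: nonneg_summable_on_complete)

lemma ennreal_sum_le_infsum:
  fixes f :: "'a \<Rightarrow> ennreal"
  assumes "finite F" "F \<subseteq> S"
  shows "sum f F \<le> infsum f S"
  using infsum_mono_neutral[of f F f S] assms by (auto simp: ennreal_summable_on)

lemma ennreal_infsum_cmult_le:
  fixes f :: "'a \<Rightarrow> ennreal"
  shows "(\<Sum>\<^sub>\<infinity>x\<in>S. c * f x) \<le> c * infsum f S"
  by (rule infsum_le_finite_sums)
     (auto simp: ennreal_summable_on simp flip: sum_distrib_left
       intro!: mult_left_mono ennreal_sum_le_infsum)

lemma ennreal_infsum_finite_sum: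
  fixes f :: "'a \<Rightarrow> 'b \<Rightarrow> ennreal"
  assumes "finite F"
  shows "(\<Sum>x\<in>F. \<Sum>\<^sub>\<infinity>y\<in>S. f x y) = (\<Sum>\<^sub>\<infinity>y\<in>S. \<Sum>x\<in>F. f x y)"
  using assms by induction (simp_all add: infsum_add ennreal_summable_on)

text \<open>
  Holds for arbitrary index sets, because finite partial sums of the outer series may be moved
  inside.
\<close>

lemma ennreal_infsum_swap_le:
  fixes f :: "'a \<Rightarrow> 'b \<Rightarrow> ennreal"
  shows "(\<Sum>\<^sub>\<infinity>x\<in>S. \<Sum>\<^sub>\<infinity>y\<in>T. f x y) \<le> (\<Sum>\<^sub>\<infinity>y\<in>T. \<Sum>\<^sub>\<infinity>x\<in>S. f x y)"
proof (rule infsum_le_finite_sums)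
  fix F assume "finite F" "F \<subseteq> S"
  then show "(\<Sum>x\<in>F. \<Sum>\<^sub>\<infinity>y\<in>T. f x y) \<le> (\<Sum>\<^sub>\<infinity>y\<in>T. \<Sum>\<^sub>\<infinity>x\<in>S. f x y)"
    unfolding ennreal_infsum_finite_sum[OF \<open>finite F\<close>]
    by (intro infsum_mono ennreal_sum_le_infsum ennreal_summable_on)
qed (rule ennreal_summable_on)

lemma summable_on_of_ennreal_infsum_finite:
  assumes nn: "\<And>x. x \<in> S \<Longrightarrow> 0 \<le> f x" and fin: "(\<Sum>\<^sub>\<infinity>x\<in>S. ennreal (f x)) < \<infinity>"
  shows "f summable_on S" "(\<Sum>\<^sub>\<infinity>x\<in>S. ennreal (f x)) = ennreal (infsum f S)"
proof -
  obtain B where B: "0 \<le> B" "(\<Sum>\<^sub>\<infinity>x\<in>S. ennreal (f x)) = ennreal B"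
    using fin by (cases "\<Sum>\<^sub>\<infinity>x\<in>S. ennreal (f x)") auto
  have "sum f F \<le> B" if "finite F" "F \<subseteq> S" for F
  proof -
    have "ennreal (sum f F) = (\<Sum>x\<in>F. ennreal (f x))"
      using that nn by (intro sum_ennreal[symmetric]) auto
    also have "\<dots> \<le> ennreal B"
      unfolding B(2)[symmetric] by (rule ennreal_sum_le_infsum[OF that])
    finally show ?thesis using B(1) by simp
  qed
  then show summ: "f summable_on S"
    by (intro nonneg_bdd_above_summable_on nn bdd_aboveI2) auto
  have "((\<lambda>F. ennreal (sum f F)) \<longlongrightarrow> ennreal (infsum f S)) (finite_subsets_at_top S)"
    using has_sum_infsum[OF summ] unfolding has_sum_def by (rule tendsto_ennrealI)
  moreover have "\<forall>\<^sub>F F in finite_subsets_at_top S. ennreal (sum f F) = (\<Sum>x\<in>F. ennreal (f x))"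
    using nn by (intro eventually_finite_subsets_at_top_weakI sum_ennreal[symmetric]) auto
  ultimately have "((\<lambda>x. ennreal (f x)) has_sum ennreal (infsum f S)) S"
    unfolding has_sum_def by (simp add: tendsto_cong)
  then show "(\<Sum>\<^sub>\<infinity>x\<in>S. ennreal (f x)) = ennreal (infsum f S)" by (rule infsumI)
qed

lemma ennreal_powr_mono:
  assumes "a \<le> b" "0 \<le> r"
  shows "ennreal_powr a r \<le> ennreal_powr b r"
proof (cases "b = \<infinity>")
  case False
  then have "a \<noteq> \<infinity>" "enn2real a \<le> enn2real b"
    using assms(1) by (auto simp: enn2real_mono less_top top_unique)
  then show ?thesis
    using False assms(2) by (auto simp: ennreal_powr_def intro!: ennreal_leI powr_mono2)
qed (simp add: ennreal_powr_def)

lemma ennreal_powr_half_scale: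
  assumes "0 < c"
  shows "ennreal_powr (ennreal (1 / c\<^sup>2) * a) (1/2) = ennreal (1 / c) * ennreal_powr a (1/2)"
proof (cases a)
  case (real r)
  have "(1 / c\<^sup>2 * r) powr (1/2) = 1 / c * r powr (1/2)"
    using assms real(1) by (simp add: powr_half_sqrt real_sqrt_divide)
  then show ?thesis
    using real assms by (simp add: ennreal_powr_def flip: ennreal_mult)
next
  case top
  then show ?thesis using assms by (simp add: ennreal_powr_def ennreal_mult_top)
qed

lemma ennreal_powr_finite_iff: "ennreal_powr a r < \<infinity> \<longleftrightarrow> a < \<infinity>"
  by (simp add: ennreal_powr_def less_top)

section \<open>Weighted means over the planes orthogonal to a frequency\<close>

lemma weighted_Cauchy_Schwarz:
  fixes x :: "'a \<Rightarrow> complex"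
  assumes w: "(\<lambda>A. (w A)\<^sup>2) summable_on S"
    and x: "(\<lambda>A. (w A)\<^sup>2 * (norm (x A))\<^sup>2) summable_on S"
  shows "(\<lambda>A. of_real ((w A)\<^sup>2) * x A) summable_on S"
    and "(norm (\<Sum>\<^sub>\<infinity>A\<in>S. of_real ((w A)\<^sup>2) * x A))\<^sup>2 \<le>
      (\<Sum>\<^sub>\<infinity>A\<in>S. (w A)\<^sup>2) * (\<Sum>\<^sub>\<infinity>A\<in>S. (w A)\<^sup>2 * (norm (x A))\<^sup>2)"
proof -
  let ?W = "\<Sum>\<^sub>\<infinity>A\<in>S. (w A)\<^sup>2" and ?X = "\<Sum>\<^sub>\<infinity>A\<in>S. (w A)\<^sup>2 * (norm (x A))\<^sup>2"
  have nn: "0 \<le> ?W" "0 \<le> ?X" by (auto intro!: infsum_nonneg)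
  have finite: "(\<Sum>A\<in>F. (w A)\<^sup>2 * norm (x A)) \<le> sqrt (?W * ?X)" if F: "finite F" "F \<subseteq> S" for F
  proof (rule real_le_rsqrt)
    have "(\<Sum>A\<in>F. (w A)\<^sup>2 * norm (x A))\<^sup>2 = (\<Sum>A\<in>F. \<bar>w A\<bar> * (\<bar>w A\<bar> * norm (x A)))\<^sup>2"
      by (simp add: power2_eq_square flip: mult.assoc)
    also have "\<dots> \<le> (\<Sum>A\<in>F. \<bar>w A\<bar>\<^sup>2) * (\<Sum>A\<in>F. (\<bar>w A\<bar> * norm (x A))\<^sup>2)"
      by (rule Cauchy_Schwarz_ineq_sum)
    also have "\<dots> = (\<Sum>A\<in>F. (w A)\<^sup>2) * (\<Sum>A\<in>F. (w A)\<^sup>2 * (norm (x A))\<^sup>2)"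
      by (simp add: power_mult_distrib)
    also have "\<dots> \<le> ?W * ?X"
      by (intro mult_mono finite_sum_le_infsum w x F nn sum_nonneg) auto
    finally show "(\<Sum>A\<in>F. (w A)\<^sup>2 * norm (x A))\<^sup>2 \<le> ?W * ?X" .
  qed
  have norm: "norm (of_real ((w A)\<^sup>2) * x A) = (w A)\<^sup>2 * norm (x A)" for A
    by (simp add: norm_mult norm_power)
  have abs: "(\<lambda>A. norm (of_real ((w A)\<^sup>2) * x A)) summable_on S"
    unfolding norm using finite by (intro nonneg_bdd_above_summable_on bdd_aboveI2) auto
  then show "(\<lambda>A. of_real ((w A)\<^sup>2) * x A) summable_on S"
    by (rule abs_summable_summable)
  have "norm (\<Sum>\<^sub>\<infinity>A\<in>S. of_real ((w A)\<^sup>2) * x A) \<le> (\<Sum>\<^sub>\<infinity>A\<in>S. (w A)\<^sup>2 * norm (x A))"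
    using norm_infsum_bound[OF abs] unfolding norm .
  also have "\<dots> \<le> sqrt (?W * ?X)"
    by (rule infsum_le_finite_sums[OF abs[unfolded norm] finite])
  finally have "(norm (\<Sum>\<^sub>\<infinity>A\<in>S. of_real ((w A)\<^sup>2) * x A))\<^sup>2 \<le> (sqrt (?W * ?X))\<^sup>2"
    by (rule power_mono) simp
  then show "(norm (\<Sum>\<^sub>\<infinity>A\<in>S. of_real ((w A)\<^sup>2) * x A))\<^sup>2 \<le> ?W * ?X"
    using nn by simp
qed

text \<open>
  Finiteness of the norm bounds each single coefficient by a multiple of \<open>\<langle>k\<rangle>\<^sup>-\<^sup>s\<close>, so the
  coefficients grow at most polynomially.
\<close>

lemma fourier_series_Hs_space:
  fixes b :: "int^'n \<Rightarrow> complex"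
  assumes fin: "ennreal_powr (\<Sum>\<^sub>\<infinity>k. ennreal (bracket k powr (2 * s) * (norm (b k))\<^sup>2)) (1/2) < \<infinity>"
  shows "fourier_series b \<in> Hs_space s"
proof -
  let ?f = "\<lambda>k. bracket k powr (2 * s) * (norm (b k))\<^sup>2"
  have fin': "(\<Sum>\<^sub>\<infinity>k. ennreal (?f k)) < \<infinity>"
    using fin by (simp only: ennreal_powr_finite_iff)
  then have summ: "?f summable_on UNIV"
    by (intro summable_on_of_ennreal_infsum_finite) auto
  \<comment> \<open>An integer exponent dominating \<open>-s\<close>, whatever the sign of \<open>s\<close>.\<close>
  define N where "N = nat \<lceil>\<bar>s\<bar>\<rceil>"
  have "norm (b k) \<le> sqrt (infsum ?f UNIV) * bracket k ^ N" for k
  proof -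
    have "?f k \<le> infsum ?f UNIV"
      using finite_sum_le_infsum[OF summ, of "{k}"] by auto
    then have "sqrt (?f k) \<le> sqrt (infsum ?f UNIV)" by simp
    moreover have "sqrt (?f k) = bracket k powr s * norm (b k)"
    proof -
      have "bracket k powr (2 * s) = (bracket k powr s)\<^sup>2"
        by (simp add: power2_eq_square flip: powr_add)
      then show ?thesis by (simp add: real_sqrt_mult)
    qed
    ultimately have "bracket k powr s * norm (b k) \<le> sqrt (infsum ?f UNIV)" by simp
    then have "bracket k powr (- s) * (bracket k powr s * norm (b k)) \<le>
        bracket k powr (- s) * sqrt (infsum ?f UNIV)"
      by (intro mult_left_mono) auto
    moreover have "bracket k powr (- s) * (bracket k powr s * norm (b k)) = norm (b k)"
      using bracket_pos[of k] by (simp add: powr_minus field_simps)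
    moreover have "bracket k powr (- s) \<le> bracket k ^ N"
    proof -
      have "- s \<le> real N" unfolding N_def by linarith
      then have "bracket k powr (- s) \<le> bracket k powr (real N)"
        by (intro powr_mono bracket_ge_1)
      then show ?thesis by (simp add: powr_realpow)
    qed
    ultimately have "norm (b k) \<le> bracket k powr (- s) * sqrt (infsum ?f UNIV)"
      "bracket k powr (- s) * sqrt (infsum ?f UNIV) \<le> bracket k ^ N * sqrt (infsum ?f UNIV)"
      by (simp_all only:) (intro mult_right_mono real_sqrt_ge_zero infsum_nonneg, auto)
    then show ?thesis by (simp only: mult.commute[of "sqrt _"] order_trans)
  qed
  then have "fourier_series b \<in> distributions" by (rule fourier_series_distribution)
  then show ?thesis using fin by (simp add: Hs_space_def Hs_norm_def)
qed

locale radon_weight =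
  fixes d :: nat and w :: "int^'n \<Rightarrow> (rat^'n) set \<Rightarrow> real" and c :: real
  assumes c_pos: "0 < c" and weight_sum_ge: "c\<^sup>2 \<le> weight_sum d w k"
begin

text \<open>
  The mean of \<open>x A k\<close> over \<open>A \<in> \<Omega>\<^sub>k\<close> with weights \<open>w(k,A)\<^sup>2 / W\<^sub>k\<close>. With the Fourier coefficients
  of a family \<open>g\<close> for \<open>x\<close>, these are the coefficients of \<open>F\<^bsub>1/W\<^esub> R\<^sub>d\<^sup>* g\<close>.
\<close>

definition average :: "((rat^'n) set \<Rightarrow> int^'n \<Rightarrow> complex) \<Rightarrow> int^'n \<Rightarrow> complex" where
  "average x k = of_real (inverse (weight_sum d w k)) *
     (\<Sum>\<^sub>\<infinity>A\<in>\<Omega> d k. of_real ((w k A)\<^sup>2) * x A k)"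

lemma weight_sum_pos: "0 < weight_sum d w k"
  using weight_sum_ge[of k] c_pos by (smt (verit) zero_less_power)

lemma weights_summable: "(\<lambda>A. (w k A)\<^sup>2) summable_on \<Omega> d k"
  using weight_sum_pos[of k] infsum_not_exists[of "\<lambda>A. (w k A)\<^sup>2" "\<Omega> d k"]
  by (auto simp: weight_sum_def)

lemma average_constant: "(\<And>A. A \<in> \<Omega> d k \<Longrightarrow> x A k = z) \<Longrightarrow> average x k = z"
proof -
  assume x: "\<And>A. A \<in> \<Omega> d k \<Longrightarrow> x A k = z"
  have "((\<lambda>A. (w k A)\<^sup>2) has_sum weight_sum d w k) (\<Omega> d k)"
    unfolding weight_sum_def by (rule has_sum_infsum[OF weights_summable])
  then have "((\<lambda>A. of_real ((w k A)\<^sup>2) * z) has_sum of_real (weight_sum d w k) * z) (\<Omega> d k)"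
    by (intro has_sum_cmult_left has_sum_of_real)
  then have "(\<Sum>\<^sub>\<infinity>A\<in>\<Omega> d k. of_real ((w k A)\<^sup>2) * x A k) = of_real (weight_sum d w k) * z"
    using x by (simp add: infsumI cong: infsum_cong)
  then show ?thesis
    using weight_sum_pos[of k] by (simp add: average_def)
qed

text \<open>
  The Cauchy-Schwarz inequality contributes one factor \<open>W\<^sub>k\<close>, the normalisation of the mean
  \<open>W\<^sub>k\<^sup>-\<^sup>2\<close>. An infinite right-hand side makes the bound trivial.
\<close>

lemma average_mode_bound:
  "ennreal (bracket k powr (2 * s) * (norm (average x k))\<^sup>2) \<le> ennreal (1 / c\<^sup>2) *
     (\<Sum>\<^sub>\<infinity>A\<in>\<Omega> d k. ennreal ((w k A)\<^sup>2 * bracket k powr (2 * s) * (norm (x A k))\<^sup>2))"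
proof (cases "(\<Sum>\<^sub>\<infinity>A\<in>\<Omega> d k. ennreal ((w k A)\<^sup>2 * bracket k powr (2 * s) * (norm (x A k))\<^sup>2)) < \<infinity>")
  case True
  let ?W = "weight_sum d w k" and ?\<beta> = "bracket k powr (2 * s)"
  let ?f = "\<lambda>A. (w k A)\<^sup>2 * ?\<beta> * (norm (x A k))\<^sup>2"
  let ?X = "\<Sum>\<^sub>\<infinity>A\<in>\<Omega> d k. (w k A)\<^sup>2 * (norm (x A k))\<^sup>2"
  have b: "0 < ?\<beta>" using bracket_pos[of k] by simp
  note f = summable_on_of_ennreal_infsum_finite[OF _ True]
  have f_eq: "?f = (\<lambda>A. ?\<beta> * ((w k A)\<^sup>2 * (norm (x A k))\<^sup>2))" by (simp add: mult_ac)
  have summ: "(\<lambda>A. (w k A)\<^sup>2 * (norm (x A k))\<^sup>2) summable_on \<Omega> d k"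
  proof -
    have "?f summable_on \<Omega> d k" by (rule f(1)) simp
    then show ?thesis using b unfolding f_eq by (subst (asm) summable_on_cmult_right') auto
  qed
  have X: "0 \<le> ?X" by (rule infsum_nonneg) simp
  have "(norm (average x k))\<^sup>2 =
      (norm (\<Sum>\<^sub>\<infinity>A\<in>\<Omega> d k. of_real ((w k A)\<^sup>2) * x A k))\<^sup>2 / ?W\<^sup>2"
    using weight_sum_pos[of k]
    by (simp add: average_def norm_mult norm_inverse power_mult_distrib power_inverse divide_inverse mult.commute)
  also have "\<dots> \<le> (?W * ?X) / ?W\<^sup>2"
    using weighted_Cauchy_Schwarz(2)[OF weights_summable summ]
    by (intro divide_right_mono) (simp_all add: weight_sum_def)
  also have "\<dots> = ?X / ?W"
    using weight_sum_pos[of k] by (simp add: power2_eq_square)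
  also have "\<dots> \<le> ?X / c\<^sup>2"
    by (intro divide_left_mono weight_sum_ge X mult_pos_pos weight_sum_pos) (use c_pos in simp)
  finally have "(norm (average x k))\<^sup>2 \<le> ?X / c\<^sup>2" .
  from mult_left_mono[OF this less_imp_le[OF b]]
  have "?\<beta> * (norm (average x k))\<^sup>2 \<le> 1 / c\<^sup>2 * (?\<beta> * ?X)"
    by (simp add: mult_ac)
  also have "?\<beta> * ?X = infsum ?f (\<Omega> d k)"
    unfolding f_eq by (rule infsum_cmult_right'[symmetric])
  finally have "ennreal (?\<beta> * (norm (average x k))\<^sup>2) \<le> ennreal (1 / c\<^sup>2 * infsum ?f (\<Omega> d k))"
    by (rule ennreal_leI)
  also have "\<dots> = ennreal (1 / c\<^sup>2) * ennreal (infsum ?f (\<Omega> d k))"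
    by (rule ennreal_mult) (auto intro!: infsum_nonneg)
  finally show ?thesis using f(2) by simp
next
  case False
  then show ?thesis using c_pos by (simp add: less_top[symmetric] ennreal_mult_top)
qed

text \<open>
  The single estimate behind both the Lipschitz bound and the stability estimate.
\<close>

lemma average_bound:
  "ennreal_powr (\<Sum>\<^sub>\<infinity>k. ennreal (bracket k powr (2 * s) * (norm (average x k))\<^sup>2)) (1/2) \<le>
   ennreal (1 / c) * ennreal_powr (\<Sum>\<^sub>\<infinity>A\<in>Gr d. \<Sum>\<^sub>\<infinity>k.
       ennreal ((w k A)\<^sup>2 * bracket k powr (2 * s) * (norm (x A k))\<^sup>2)) (1/2)"
proof -
  let ?f = "\<lambda>k A. ennreal ((w k A)\<^sup>2 * bracket k powr (2 * s) * (norm (x A k))\<^sup>2)"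
  have "(\<Sum>\<^sub>\<infinity>k. ennreal (bracket k powr (2 * s) * (norm (average x k))\<^sup>2)) \<le>
      (\<Sum>\<^sub>\<infinity>k. ennreal (1 / c\<^sup>2) * (\<Sum>\<^sub>\<infinity>A\<in>\<Omega> d k. ?f k A))"
    by (intro infsum_mono average_mode_bound ennreal_summable_on)
  also have "\<dots> \<le> ennreal (1 / c\<^sup>2) * (\<Sum>\<^sub>\<infinity>k. \<Sum>\<^sub>\<infinity>A\<in>\<Omega> d k. ?f k A)"
    by (rule ennreal_infsum_cmult_le)
  also have "\<dots> \<le> ennreal (1 / c\<^sup>2) * (\<Sum>\<^sub>\<infinity>k. \<Sum>\<^sub>\<infinity>A\<in>Gr d. ?f k A)"
    by (intro mult_left_mono infsum_mono infsum_mono_neutral ennreal_summable_on) (auto simp: \<Omega>_def)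
  also have "\<dots> \<le> ennreal (1 / c\<^sup>2) * (\<Sum>\<^sub>\<infinity>A\<in>Gr d. \<Sum>\<^sub>\<infinity>k. ?f k A)"
    by (intro mult_left_mono ennreal_infsum_swap_le) auto
  finally show ?thesis
    unfolding ennreal_powr_half_scale[OF c_pos, symmetric] by (intro ennreal_powr_mono) auto
qed

lemma adjoint_sum_summable:
  fixes x :: "(rat^'n) set \<Rightarrow> int^'n \<Rightarrow> complex"
  assumes "(\<Sum>\<^sub>\<infinity>A\<in>Gr d. \<Sum>\<^sub>\<infinity>k. ennreal ((w k A)\<^sup>2 * bracket k powr (2 * s) * (norm (x A k))\<^sup>2)) < \<infinity>"
  shows "(\<lambda>A. of_real ((w k A)\<^sup>2) * x A k) summable_on \<Omega> d k"
proof -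
  let ?f = "\<lambda>k A. (w k A)\<^sup>2 * bracket k powr (2 * s) * (norm (x A k))\<^sup>2"
  have "(\<Sum>\<^sub>\<infinity>A\<in>\<Omega> d k. ennreal (?f k A)) \<le> (\<Sum>\<^sub>\<infinity>A\<in>Gr d. ennreal (?f k A))"
    by (intro infsum_mono_neutral ennreal_summable_on) (auto simp: \<Omega>_def)
  also have "\<dots> \<le> (\<Sum>\<^sub>\<infinity>A\<in>Gr d. \<Sum>\<^sub>\<infinity>k. ennreal (?f k A))"
    using ennreal_sum_le_infsum[of "{k}" UNIV "\<lambda>k. ennreal (?f k A)" for A]
    by (intro infsum_mono ennreal_summable_on) auto
  finally have "(\<Sum>\<^sub>\<infinity>A\<in>\<Omega> d k. ennreal (?f k A)) < \<infinity>" using assms by (rule le_less_trans)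
  then have "?f k summable_on \<Omega> d k"
    by (intro summable_on_of_ennreal_infsum_finite(1)) auto
  moreover have "?f k = (\<lambda>A. bracket k powr (2 * s) * ((w k A)\<^sup>2 * (norm (x A k))\<^sup>2))"
    by (simp add: mult_ac)
  ultimately have "(\<lambda>A. (w k A)\<^sup>2 * (norm (x A k))\<^sup>2) summable_on \<Omega> d k"
    using bracket_pos[of k] by (simp add: summable_on_cmult_right')
  then show ?thesis by (rule weighted_Cauchy_Schwarz(1)[OF weights_summable])
qed

lemma fourier_multiplier_radon_adjoint:
  "fourier_multiplier (\<lambda>k. of_real (inverse (weight_sum d w k))) (radon_adjoint d w g) =
     fourier_series (average (\<lambda>A. fourier_coeff (g A)))"
  by (simp only: fourier_multiplier_def radon_adjoint_def average_def[abs_def] fourier_coeff_fourier_series)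

text \<open>
  Linearity of the mean: finite norms make the sums over \<open>\<Omega>\<^sub>k\<close> converge separately for \<open>g\<close> and
  \<open>h\<close>.
\<close>

lemma average_diff:
  assumes "L22_norm d s w g < \<infinity>" "L22_norm d s w h < \<infinity>"
  shows "average (\<lambda>A. fourier_coeff (g A)) k - average (\<lambda>A. fourier_coeff (h A)) k =
    average (\<lambda>A. fourier_coeff ((g - h) A)) k"
proof -
  have summ: "(\<lambda>A. of_real ((w k A)\<^sup>2) * fourier_coeff (g' A) k) summable_on \<Omega> d k"
    if "L22_norm d s w g' < \<infinity>" for g'
    using that unfolding L22_norm_def ennreal_powr_finite_iff
    by (rule adjoint_sum_summable[where x = "\<lambda>A. fourier_coeff (g' A)"])
  let ?t = "\<lambda>g A. of_real ((w k A)\<^sup>2) * fourier_coeff (g A) k"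
  have t: "(?t g' has_sum infsum (?t g') (\<Omega> d k)) (\<Omega> d k)" if "L22_norm d s w g' < \<infinity>" for g'
    by (rule has_sum_infsum[OF summ[OF that]])
  have "((\<lambda>A. ?t g A - ?t h A) has_sum infsum (?t g) (\<Omega> d k) - infsum (?t h) (\<Omega> d k)) (\<Omega> d k)"
    unfolding diff_conv_add_uminus
    by (intro has_sum_add has_sum_uminusI t assms)
  moreover have "(\<lambda>A. ?t g A - ?t h A) = ?t (g - h)"
    by (simp add: fourier_coeff_def right_diff_distrib)
  ultimately show ?thesis
    by (simp only: average_def infsumI right_diff_distrib)
qed

lemma fourier_coeff_diff: "fourier_coeff (u - v) k = fourier_coeff u k - fourier_coeff v k"
  by (simp add: fourier_coeff_def)

lemma average_radon:
  assumes "f \<in> distributions"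
  shows "average (\<lambda>A. fourier_coeff (radon d f A)) = fourier_coeff f"
  by (rule ext, rule average_constant) (simp add: \<Omega>_def fourier_coeff_radon assms)

text \<open>
  Dividing the weight by \<open>\<surd>W\<^sub>k\<close> has the same effect as the multiplier \<open>W\<^sub>k\<^sup>-\<^sup>1\<close>.
\<close>

lemma radon_adjoint_normalised:
  "radon_adjoint d (\<lambda>k A. w k A / sqrt (weight_sum d w k)) g =
     fourier_series (average (\<lambda>A. fourier_coeff (g A)))"
proof -
  have "(\<Sum>\<^sub>\<infinity>A\<in>\<Omega> d k. of_real ((w k A / sqrt (weight_sum d w k))\<^sup>2) * fourier_coeff (g A) k) =
      average (\<lambda>A. fourier_coeff (g A)) k" for k
  proof -
    have "of_real ((w k A / sqrt (weight_sum d w k))\<^sup>2) * fourier_coeff (g A) k =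
        of_real (inverse (weight_sum d w k)) * (of_real ((w k A)\<^sup>2) * fourier_coeff (g A) k)" for A
    proof -
      have "(w k A / sqrt (weight_sum d w k))\<^sup>2 = inverse (weight_sum d w k) * (w k A)\<^sup>2"
        using weight_sum_pos[of k] by (simp add: power_divide divide_inverse[of "(w k A)\<^sup>2"] mult.commute)
      then show ?thesis by (simp only: of_real_mult mult.assoc)
    qed
    then show ?thesis by (simp only: average_def infsum_cmult_right')
  qed
  then show ?thesis by (simp add: radon_adjoint_def)
qed

end

section \<open>Stability and inversion of the Radon transform\<close>

theorem corollary4p10:
  fixes d :: nat and s :: real
    and w :: "int^'n \<Rightarrow> (rat^'n) set \<Rightarrow> real"
    and c_w C_w :: real
  assumes "CARD('n) \<ge> 2" and "1 \<le> d" and "d \<le> CARD('n) - 1"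
    and "\<And>k A. A \<in> Gr d \<Longrightarrow> w k A > 0"
    and "\<And>A. A \<in> Gr d \<Longrightarrow> poly_decay (\<lambda>k. w k A)"
    and "C_w > 0" and "c_w > 0"
    and "\<And>k. c_w\<^sup>2 \<le> weight_sum d w k \<and> weight_sum d w k \<le> C_w\<^sup>2"
  shows
    "(let FR = (\<lambda>g. fourier_multiplier (\<lambda>k. of_real (inverse (weight_sum d w k))) (radon_adjoint d w g))
      in (\<forall>g\<in>L22_space d s w. FR g \<in> Hs_space s) \<and>
         (\<forall>g\<in>L22_space d s w. \<forall>h\<in>L22_space d s w.
            Hs_norm s (FR g - FR h) \<le> ennreal (1 / c_w) * L22_norm d s w (g - h)))
     \<and>
     (\<forall>f\<in>distributions. Hs_norm s f \<le> ennreal (1 / c_w) * L22_norm d s w (radon d f))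
     \<and>
     (let w' = (\<lambda>k A. w k A / sqrt (weight_sum d w k))
      in \<forall>f\<in>distributions.
           radon_adjoint d w' (radon d f) = f \<and>
           (\<forall>p::ennreal. 1 \<le> p \<longrightarrow>
              Lps_norm p s f = Lps_norm p s (radon_adjoint d w' (radon d f))))"
proof -
  interpret radon_weight d w c_w
    using assms by unfold_locales auto
  let ?M = "\<lambda>g. average (\<lambda>A. fourier_coeff (g A))"
  have bound: "ennreal_powr (\<Sum>\<^sub>\<infinity>k. ennreal (bracket k powr (2 * s) * (norm (?M g k))\<^sup>2)) (1/2)
      \<le> ennreal (1 / c_w) * L22_norm d s w g" for g
    unfolding L22_norm_def by (rule average_bound)
  have inverse: "radon_adjoint d (\<lambda>k A. w k A / sqrt (weight_sum d w k)) (radon d f) = f"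
    if "f \<in> distributions" for f
    by (simp add: radon_adjoint_normalised average_radon distribution_fourier_series that)
  have "fourier_series (?M g) \<in> Hs_space s" if "g \<in> L22_space d s w" for g
  proof (rule fourier_series_Hs_space, rule le_less_trans[OF bound])
    show "ennreal (1 / c_w) * L22_norm d s w g < \<infinity>"
      using that by (simp add: L22_space_def ennreal_mult_less_top)
  qed
  moreover have "Hs_norm s (fourier_series (?M g) - fourier_series (?M h)) \<le>
      ennreal (1 / c_w) * L22_norm d s w (g - h)"
    if "g \<in> L22_space d s w" "h \<in> L22_space d s w" for g h
    using that bound[of "g - h"]
    by (simp add: Hs_norm_def fourier_coeff_diff average_diff[of s] L22_space_def)
  moreover have "Hs_norm s f \<le> ennreal (1 / c_w) * L22_norm d s w (radon d f)"
    if "f \<in> distributions" for f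
    using bound[of "radon d f"] by (simp add: Hs_norm_def average_radon that)
  ultimately show ?thesis
    unfolding Let_def fourier_multiplier_radon_adjoint by (simp add: inverse)
qed

end
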